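(* For every $\beta\in(0,1)$, algorithm CombinedApprox is a polynomial-time approximation algorithm for MS-OPT with approximation ratio $1+\sqrt{n}$, where $n$ is the number of vertices of the task graph; i.e. it outputs a reward $r$ and a subgraph of $G$ motivating for $r$ with $r\le(1+\sqrt n)\, r^*$, where $r^*$ is the minimum reward for which $G$ has a motivating subgraph.
   Context: A task graph is a finite directed acyclic graph $G=(V,E)$ with $n$ vertices, source $s$, target $t$ and non-negative edge costs $c_G(v,w)$; assume $t$ is reachable from $s$. For bias factor $\beta$, let $d_G(w)$ be the minimum cost of a path from $w$ to $t$ ($\infty$ if none), and for $v$ with an outgoing edge let $\zeta_G(v)=\min\{c_G(v,w)+\beta d_G(w):(v,w)\in E\}$ ($\infty$ otherwise). With reward $r\ge0$ at $t$, the agent starts at $s$ and at each vertex $v\ne t$ either moves along an edge $(v,w)$ attaining $\zeta_G(v)$ (ties arbitrary) if $\zeta_G(v)\le\beta r$, or abandons if $\zeta_G(v)>\beta r$. $G$ is motivating if for all tie-breakings the agent reaches $t$. A subgraph is obtained by deleting edges. MS-OPT: given $G$ and $\beta\in(0,1)$, find the minimum $r$ such that $G$ has a subgraph motivating for $r$. MinmaxPathApprox: compute an $s$-$t$ path $P$ minimizing the maximum edge cost on it; CheapestPathApprox: compute an $s$-$t$ path $P$ of minimum total cost; in both cases output $G'$ consisting of exactly the edges of $P$ and $r=\max\{\zeta_{G'}(v):v\in P, v\ne t\}/\beta$. CombinedApprox runs MinmaxPathApprox if $\beta\le 1/\sqrt n$ and CheapestPathApprox otherwise. *)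

theory Defs
  imports
    "Graph_Theory.Graph_Theory"
    "HOL-Library.Log_Nat"
    "HOL-Computational_Algebra.Polynomial"
begin

section \<open>Task graphs and time-inconsistent agents\<close>

locale task_graph = pair_fin_digraph G for G :: "'a pair_pre_digraph" +
  fixes c :: "'a \<times> 'a \<Rightarrow> real" and s t :: 'a
  assumes acyclic_arcs: "acyclic (parcs G)"
    and source_in_verts: "s \<in> pverts G"
    and target_in_verts: "t \<in> pverts G"
    and cost_nonneg: "\<And>e. e \<in> parcs G \<Longrightarrow> 0 \<le> c e"
    and target_reachable: "s \<rightarrow>\<^sup>*\<^bsub>with_proj G\<^esub> t"

text \<open>
  The library's \<open>\<mu>\<close> is an infimum over walks; in a finite acyclic graph every walk is a path and
  there are only finitely many, so it is the minimum cost of a path (\<open>\<infinity>\<close> if there is none).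
\<close>

abbreviation dist_to ::
    "'a pair_pre_digraph \<Rightarrow> ('a \<times> 'a \<Rightarrow> real) \<Rightarrow> 'a \<Rightarrow> 'a \<Rightarrow> ereal" where
  "dist_to G c t w \<equiv> wf_digraph.\<mu> (with_proj G) c w t"

text \<open>
  The infimum ranges over the finitely many out-neighbours of \<open>v\<close>, hence is a minimum if there is
  at least one, and \<open>\<infinity>\<close> otherwise.
\<close>

definition zeta ::
    "real \<Rightarrow> 'a pair_pre_digraph \<Rightarrow> ('a \<times> 'a \<Rightarrow> real) \<Rightarrow> 'a \<Rightarrow> 'a \<Rightarrow> ereal" where
  "zeta \<beta> G c t v = (INF w\<in>{w. (v, w) \<in> parcs G}. ereal (c (v, w)) + ereal \<beta> * dist_to G c t w)"

text \<open>
  A tie-breaking rule chooses, at every vertex with an outgoing edge, one edge attaining \<open>zeta\<close>.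
  Memoryless rules suffice because the agent visits no vertex of an acyclic graph twice.
\<close>

definition tie_breaking ::
    "real \<Rightarrow> 'a pair_pre_digraph \<Rightarrow> ('a \<times> 'a \<Rightarrow> real) \<Rightarrow> 'a \<Rightarrow> ('a \<Rightarrow> 'a) \<Rightarrow> bool" where
  "tie_breaking \<beta> G c t \<sigma> \<longleftrightarrow>
     (\<forall>v. (\<exists>w. (v, w) \<in> parcs G) \<longrightarrow>
        (v, \<sigma> v) \<in> parcs G \<and>
        ereal (c (v, \<sigma> v)) + ereal \<beta> * dist_to G c t (\<sigma> v) = zeta \<beta> G c t v)"

inductive agent_reaches ::
    "real \<Rightarrow> 'a pair_pre_digraph \<Rightarrow> ('a \<times> 'a \<Rightarrow> real) \<Rightarrow> 'a \<Rightarrow> real \<Rightarrow> ('a \<Rightarrow> 'a) \<Rightarrow> 'a \<Rightarrow> bool"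
  for \<beta> G c t r \<sigma> where
  arrived: "agent_reaches \<beta> G c t r \<sigma> t"
| move: "v \<noteq> t \<Longrightarrow> zeta \<beta> G c t v \<le> ereal (\<beta> * r) \<Longrightarrow> agent_reaches \<beta> G c t r \<sigma> (\<sigma> v) \<Longrightarrow>
    agent_reaches \<beta> G c t r \<sigma> v"

definition motivating ::
    "real \<Rightarrow> 'a pair_pre_digraph \<Rightarrow> ('a \<times> 'a \<Rightarrow> real) \<Rightarrow> 'a \<Rightarrow> 'a \<Rightarrow> real \<Rightarrow> bool" where
  "motivating \<beta> G c s t r \<longleftrightarrow> (\<forall>\<sigma>. tie_breaking \<beta> G c t \<sigma> \<longrightarrow> agent_reaches \<beta> G c t r \<sigma> s)"

definition feasible_reward ::
    "real \<Rightarrow> 'a pair_pre_digraph \<Rightarrow> ('a \<times> 'a \<Rightarrow> real) \<Rightarrow> 'a \<Rightarrow> 'a \<Rightarrow> real \<Rightarrow> bool" where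
  "feasible_reward \<beta> G c s t r \<longleftrightarrow>
     0 \<le> r \<and> (\<exists>H. spanning (with_proj H) (with_proj G) \<and> motivating \<beta> H c s t r)"

definition ms_opt ::
    "real \<Rightarrow> 'a pair_pre_digraph \<Rightarrow> ('a \<times> 'a \<Rightarrow> real) \<Rightarrow> 'a \<Rightarrow> 'a \<Rightarrow> real \<Rightarrow> bool" where
  "ms_opt \<beta> G c s t r \<longleftrightarrow>
     feasible_reward \<beta> G c s t r \<and> (\<forall>r'. feasible_reward \<beta> G c s t r' \<longrightarrow> r \<le> r')"


section \<open>The approximation algorithms as input-output relations\<close>

text \<open>
  Only for \<open>s = t\<close> is there an empty \<open>s\<close>-\<open>t\<close> path, and then it is the only one, so the value of
  \<open>Max\<close> on the empty set is immaterial.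
\<close>

definition minmax_path ::
    "'a pair_pre_digraph \<Rightarrow> ('a \<times> 'a \<Rightarrow> real) \<Rightarrow> 'a \<Rightarrow> 'a \<Rightarrow> ('a \<times> 'a) awalk \<Rightarrow> bool" where
  "minmax_path G c s t P \<longleftrightarrow>
     pre_digraph.apath (with_proj G) s P t \<and>
     (\<forall>Q. pre_digraph.apath (with_proj G) s Q t \<longrightarrow> Max (c ` set P) \<le> Max (c ` set Q))"

definition cheapest_path ::
    "'a pair_pre_digraph \<Rightarrow> ('a \<times> 'a \<Rightarrow> real) \<Rightarrow> 'a \<Rightarrow> 'a \<Rightarrow> ('a \<times> 'a) awalk \<Rightarrow> bool" where
  "cheapest_path G c s t P \<longleftrightarrow>
     pre_digraph.apath (with_proj G) s P t \<and>
     (\<forall>Q. pre_digraph.apath (with_proj G) s Q t \<longrightarrow>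
        wf_digraph.awalk_cost c P \<le> wf_digraph.awalk_cost c Q)"

text \<open>
  The supremum is over finitely many vertices, hence a maximum. For \<open>s = t\<close> there are none: the
  supremum is \<open>-\<infinity>\<close>, which \<open>real_of_ereal\<close> maps to \<open>0\<close>, so the reward is \<open>0\<close>.
\<close>

definition path_reward ::
    "real \<Rightarrow> 'a pair_pre_digraph \<Rightarrow> ('a \<times> 'a \<Rightarrow> real) \<Rightarrow> 'a \<Rightarrow> 'a \<Rightarrow> ('a \<times> 'a) awalk \<Rightarrow> real" where
  "path_reward \<beta> H c s t P =
     real_of_ereal (SUP v\<in>set (pawalk_verts s P) - {t}. zeta \<beta> H c t v) / \<beta>"

definition path_output ::
    "real \<Rightarrow> 'a pair_pre_digraph \<Rightarrow> ('a \<times> 'a \<Rightarrow> real) \<Rightarrow> 'a \<Rightarrow> 'a \<Rightarrow> ('a \<times> 'a) awalk \<Rightarrow>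
      'a pair_pre_digraph \<Rightarrow> real \<Rightarrow> bool" where
  "path_output \<beta> G c s t P H r \<longleftrightarrow>
     H = \<lparr>pverts = pverts G, parcs = set P\<rparr> \<and> r = path_reward \<beta> H c s t P"

definition minmax_path_approx ::
    "real \<Rightarrow> 'a pair_pre_digraph \<Rightarrow> ('a \<times> 'a \<Rightarrow> real) \<Rightarrow> 'a \<Rightarrow> 'a \<Rightarrow>
      'a pair_pre_digraph \<Rightarrow> real \<Rightarrow> bool" where
  "minmax_path_approx \<beta> G c s t H r \<longleftrightarrow>
     (\<exists>P. minmax_path G c s t P \<and> path_output \<beta> G c s t P H r)"

definition cheapest_path_approx ::
    "real \<Rightarrow> 'a pair_pre_digraph \<Rightarrow> ('a \<times> 'a \<Rightarrow> real) \<Rightarrow> 'a \<Rightarrow> 'a \<Rightarrow>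
      'a pair_pre_digraph \<Rightarrow> real \<Rightarrow> bool" where
  "cheapest_path_approx \<beta> G c s t H r \<longleftrightarrow>
     (\<exists>P. cheapest_path G c s t P \<and> path_output \<beta> G c s t P H r)"

definition combined_approx ::
    "real \<Rightarrow> 'a pair_pre_digraph \<Rightarrow> ('a \<times> 'a \<Rightarrow> real) \<Rightarrow> 'a \<Rightarrow> 'a \<Rightarrow>
      'a pair_pre_digraph \<Rightarrow> real \<Rightarrow> bool" where
  "combined_approx \<beta> G c s t H r \<longleftrightarrow>
     (if \<beta> \<le> 1 / sqrt (real (card (pverts G)))
      then minmax_path_approx \<beta> G c s t H r
      else cheapest_path_approx \<beta> G c s t H r)"


section \<open>A random access machine with natural and real registers\<close>

text \<open>
  Structured programs over two infinite memories, one of natural numbers (with indirect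
  addressing) and one of reals. Evaluating an expression charges every node the size of its value,
  addresses included. Naturals are always charged their bit length (logarithmic cost criterion).
  For reals the charge is a parameter \<open>sz\<close>: the constant \<open>1\<close> gives the arithmetic (real RAM)
  model, and \<open>real_bits\<close> below gives the bit model on rational data.
\<close>

datatype nexp =
    NConst nat
  | NMem nexp
  | NAdd nexp nexp
  | NSub nexp nexp
  | NMul nexp nexp

datatype rexp =
    RNat nexp
  | RMem nexp
  | RAdd rexp rexp
  | RSub rexp rexp
  | RMul rexp rexp
  | RDiv rexp rexp

datatype bexp =
    NLe nexp nexp
  | RLe rexp rexp
  | BNot bexp
  | BAnd bexp bexp

datatype com =
    Skip
  | NStore nexp nexp
  | RStore nexp rexp
  | Seq com com
  | Cond bexp com com
  | Loop bexp com

type_synonym nmem = "nat \<Rightarrow> nat"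
type_synonym rmem = "nat \<Rightarrow> real"

definition nat_bits :: "nat \<Rightarrow> nat" where
  "nat_bits k = Suc (floorlog 2 k)"

text \<open>Numerator plus denominator in lowest terms; meaningful for rational \<open>x\<close> only.\<close>

definition real_bits :: "real \<Rightarrow> nat" where
  "real_bits x =
     (case quotient_of (inv (of_rat :: rat \<Rightarrow> real) x) of
        (a, b) \<Rightarrow> nat_bits (nat \<bar>a\<bar>) + nat_bits (nat b))"

primrec nval :: "nexp \<Rightarrow> nmem \<Rightarrow> nat" where
  "nval (NConst k) m = k"
| "nval (NMem a) m = m (nval a m)"
| "nval (NAdd a b) m = nval a m + nval b m"
| "nval (NSub a b) m = nval a m - nval b m"
| "nval (NMul a b) m = nval a m * nval b m"

primrec ncost :: "nexp \<Rightarrow> nmem \<Rightarrow> nat" where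
  "ncost (NConst k) m = nat_bits k"
| "ncost (NMem a) m = ncost a m + nat_bits (nval (NMem a) m)"
| "ncost (NAdd a b) m = ncost a m + ncost b m + nat_bits (nval (NAdd a b) m)"
| "ncost (NSub a b) m = ncost a m + ncost b m + nat_bits (nval (NSub a b) m)"
| "ncost (NMul a b) m = ncost a m + ncost b m + nat_bits (nval (NMul a b) m)"

primrec rval :: "rexp \<Rightarrow> nmem \<Rightarrow> rmem \<Rightarrow> real" where
  "rval (RNat a) m x = real (nval a m)"
| "rval (RMem a) m x = x (nval a m)"
| "rval (RAdd a b) m x = rval a m x + rval b m x"
| "rval (RSub a b) m x = rval a m x - rval b m x"
| "rval (RMul a b) m x = rval a m x * rval b m x"
| "rval (RDiv a b) m x = rval a m x / rval b m x"

primrec rcost :: "(real \<Rightarrow> nat) \<Rightarrow> rexp \<Rightarrow> nmem \<Rightarrow> rmem \<Rightarrow> nat" where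
  "rcost sz (RNat a) m x = ncost a m + sz (rval (RNat a) m x)"
| "rcost sz (RMem a) m x = ncost a m + sz (rval (RMem a) m x)"
| "rcost sz (RAdd a b) m x = rcost sz a m x + rcost sz b m x + sz (rval (RAdd a b) m x)"
| "rcost sz (RSub a b) m x = rcost sz a m x + rcost sz b m x + sz (rval (RSub a b) m x)"
| "rcost sz (RMul a b) m x = rcost sz a m x + rcost sz b m x + sz (rval (RMul a b) m x)"
| "rcost sz (RDiv a b) m x = rcost sz a m x + rcost sz b m x + sz (rval (RDiv a b) m x)"

primrec bval :: "bexp \<Rightarrow> nmem \<Rightarrow> rmem \<Rightarrow> bool" where
  "bval (NLe a b) m x \<longleftrightarrow> nval a m \<le> nval b m"
| "bval (RLe a b) m x \<longleftrightarrow> rval a m x \<le> rval b m x"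
| "bval (BNot p) m x \<longleftrightarrow> \<not> bval p m x"
| "bval (BAnd p q) m x \<longleftrightarrow> bval p m x \<and> bval q m x"

primrec bcost :: "(real \<Rightarrow> nat) \<Rightarrow> bexp \<Rightarrow> nmem \<Rightarrow> rmem \<Rightarrow> nat" where
  "bcost sz (NLe a b) m x = ncost a m + ncost b m + 1"
| "bcost sz (RLe a b) m x = rcost sz a m x + rcost sz b m x + 1"
| "bcost sz (BNot p) m x = bcost sz p m x + 1"
| "bcost sz (BAnd p q) m x = bcost sz p m x + bcost sz q m x + 1"

text \<open>\<open>exec sz prog \<sigma> k \<sigma>'\<close>: started in \<open>\<sigma>\<close>, the program halts in \<open>\<sigma>'\<close> at total cost \<open>k\<close>.\<close>

inductive exec :: "(real \<Rightarrow> nat) \<Rightarrow> com \<Rightarrow> nmem \<times> rmem \<Rightarrow> nat \<Rightarrow> nmem \<times> rmem \<Rightarrow> bool"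
  for sz where
  Skip: "exec sz Skip \<sigma> 1 \<sigma>"
| NStore: "exec sz (NStore a e) (m, x) (ncost a m + ncost e m + 1)
    (m(nval a m := nval e m), x)"
| RStore: "exec sz (RStore a e) (m, x) (ncost a m + rcost sz e m x + 1)
    (m, x(nval a m := rval e m x))"
| Seq: "exec sz C \<sigma> k \<sigma>' \<Longrightarrow> exec sz D \<sigma>' l \<sigma>'' \<Longrightarrow> exec sz (Seq C D) \<sigma> (k + l) \<sigma>''"
| CondTrue: "bval b m x \<Longrightarrow> exec sz C (m, x) k \<sigma>' \<Longrightarrow>
    exec sz (Cond b C D) (m, x) (bcost sz b m x + k) \<sigma>'"
| CondFalse: "\<not> bval b m x \<Longrightarrow> exec sz D (m, x) k \<sigma>' \<Longrightarrow>
    exec sz (Cond b C D) (m, x) (bcost sz b m x + k) \<sigma>'"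
| LoopFalse: "\<not> bval b m x \<Longrightarrow> exec sz (Loop b C) (m, x) (bcost sz b m x) (m, x)"
| LoopTrue: "bval b m x \<Longrightarrow> exec sz C (m, x) k \<sigma>' \<Longrightarrow> exec sz (Loop b C) \<sigma>' l \<sigma>'' \<Longrightarrow>
    exec sz (Loop b C) (m, x) (bcost sz b m x + k + l) \<sigma>''"

inductive_cases exec_SkipE: "exec sz Skip \<sigma> k \<sigma>'"
inductive_cases exec_NStoreE: "exec sz (NStore a e) \<sigma> k \<sigma>'"
inductive_cases exec_RStoreE: "exec sz (RStore a e) \<sigma> k \<sigma>'"
inductive_cases exec_SeqE: "exec sz (Seq C D) \<sigma> k \<sigma>'"
inductive_cases exec_CondE: "exec sz (Cond b C D) \<sigma> k \<sigma>'"
inductive_cases exec_LoopE: "exec sz (Loop b C) \<sigma> k \<sigma>'"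

lemma exec_deterministic:
  "exec sz C \<sigma> k \<sigma>' \<Longrightarrow> exec sz C \<sigma> l \<rho> \<Longrightarrow> l = k \<and> \<rho> = \<sigma>'"
proof (induction arbitrary: l \<rho> rule: exec.induct)
  case (Skip \<sigma>)
  then show ?case by (rule exec_SkipE) simp
next
  case (NStore a e m x)
  then show ?case by (rule exec_NStoreE) simp
next
  case (RStore a e m x)
  then show ?case by (rule exec_RStoreE) simp
next
  case (Seq C \<sigma> k \<sigma>' D l1 \<sigma>'')
  from Seq.prems obtain k' \<tau> l' where
    "exec sz C \<sigma> k' \<tau>" "exec sz D \<tau> l' \<rho>" "l = k' + l'"
    by (rule exec_SeqE)
  with Seq.IH show ?case by metis
next
  case (CondTrue b m x C k \<sigma>' D)
  from CondTrue.prems obtain k' where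
    "exec sz C (m, x) k' \<rho>" "l = bcost sz b m x + k'"
    by (rule exec_CondE) (use CondTrue.hyps(1) in auto)
  with CondTrue.IH show ?case by metis
next
  case (CondFalse b m x D k \<sigma>' C)
  from CondFalse.prems obtain k' where
    "exec sz D (m, x) k' \<rho>" "l = bcost sz b m x + k'"
    by (rule exec_CondE) (use CondFalse.hyps(1) in auto)
  with CondFalse.IH show ?case by metis
next
  case (LoopFalse b m x C)
  from LoopFalse.prems show ?case
    by (rule exec_LoopE) (use LoopFalse.hyps in auto)
next
  case (LoopTrue b m x C k \<sigma>' l1 \<sigma>'')
  from LoopTrue.prems obtain k' \<tau> l' where
    "exec sz C (m, x) k' \<tau>" "exec sz (Loop b C) \<tau> l' \<rho>" "l = bcost sz b m x + k' + l'"
    by (rule exec_LoopE) (use LoopTrue.hyps(1) in auto)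
  with LoopTrue.IH show ?case by metis
qed

text \<open>
  Input layout for graphs on the vertices \<open>0, \<dots>, n - 1\<close>. Natural memory: \<open>n\<close>, \<open>s\<close>, \<open>t\<close>, then the
  adjacency matrix row by row from cell \<open>3\<close>. Real memory: \<open>\<beta>\<close>, then the cost matrix row by row from
  cell \<open>1\<close>, with \<open>0\<close> for absent edges. All other cells are \<open>0\<close>.
\<close>

definition input_nmem :: "nat pair_pre_digraph \<Rightarrow> nat \<Rightarrow> nat \<Rightarrow> nmem" where
  "input_nmem G s t k =
     (let n = card (pverts G) in
      if k = 0 then n else if k = 1 then s else if k = 2 then t
      else if k < 3 + n * n \<and> ((k - 3) div n, (k - 3) mod n) \<in> parcs G then 1 else 0)"

definition input_rmem :: "real \<Rightarrow> nat pair_pre_digraph \<Rightarrow> (nat \<times> nat \<Rightarrow> real) \<Rightarrow> rmem" where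
  "input_rmem \<beta> G c k =
     (let n = card (pverts G) in
      if k = 0 then \<beta>
      else if k < 1 + n * n \<and> ((k - 1) div n, (k - 1) mod n) \<in> parcs G
      then c ((k - 1) div n, (k - 1) mod n) else 0)"

text \<open>
  The output is read in the same layout: the adjacency matrix of the subgraph from natural cell
  \<open>3\<close>, and the reward in real cell \<open>0\<close>.
\<close>

definition output_graph :: "nat \<Rightarrow> nmem \<times> rmem \<Rightarrow> nat pair_pre_digraph" where
  "output_graph n \<sigma> =
     \<lparr>pverts = {..<n}, parcs = {(i, j). i < n \<and> j < n \<and> fst \<sigma> (3 + i * n + j) = 1}\<rparr>"

definition output_reward :: "nmem \<times> rmem \<Rightarrow> real" where
  "output_reward \<sigma> = snd \<sigma> 0"

definition input_size ::
    "(real \<Rightarrow> nat) \<Rightarrow> real \<Rightarrow> nat pair_pre_digraph \<Rightarrow> (nat \<times> nat \<Rightarrow> real) \<Rightarrow> nat" where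
  "input_size sz \<beta> G c = (card (pverts G))\<^sup>2 + sz \<beta> + (\<Sum>e\<in>parcs G. sz (c e))"

definition runs_combined_approx_within ::
    "nat poly \<Rightarrow> (real \<Rightarrow> nat) \<Rightarrow> com \<Rightarrow> real \<Rightarrow> nat pair_pre_digraph \<Rightarrow> (nat \<times> nat \<Rightarrow> real) \<Rightarrow>
      nat \<Rightarrow> nat \<Rightarrow> bool" where
  "runs_combined_approx_within p sz prog \<beta> G c s t \<longleftrightarrow>
     (\<exists>k \<sigma>. exec sz prog (input_nmem G s t, input_rmem \<beta> G c) k \<sigma> \<and>
        k \<le> poly p (input_size sz \<beta> G c) \<and>
        combined_approx \<beta> G c s t (output_graph (card (pverts G)) \<sigma>) (output_reward \<sigma>))"

end

theory Submission
  imports Defs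
begin

text \<open>
  On a path graph the agent has no choice, so the path motivates exactly when the reward dominates
  \<open>\<zeta> / \<beta>\<close> along it. If \<open>H\<close> is motivating for \<open>r\<close>, every edge on the agent's walk costs at most
  \<open>\<beta> r\<close>, and \<open>\<zeta>(s) \<le> \<beta> r\<close> gives \<open>d(s) \<le> r\<close>. Hence a minmax path has \<open>\<zeta> \<le> \<beta> r (1 + \<beta> n)\<close>, a
  cheapest path has \<open>\<zeta> \<le> r\<close>, and \<open>1 / sqrt n\<close> is where the resulting ratios \<open>1 + \<beta> n\<close> and
  \<open>1 / \<beta>\<close> balance. The optimum exists because \<open>\<zeta>\<close> takes finitely many values over the finitely
  many subgraphs.

  Both path problems minimise a fold of the edge costs, with \<open>max\<close> or \<open>+\<close>, that is monotone in the
  tail value, so a single Bellman-Ford program solves both; the test \<open>\<beta> \<le> 1 / sqrt n\<close> becomes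
  \<open>\<beta>\<^sup>2 n \<le> 1\<close>. The largest \<open>\<zeta>\<close> on the path is maintained while tracing it forwards: appending
  \<open>e\<close> turns \<open>M\<close> into \<open>max (M + \<beta> c(e)) c(e)\<close>. Every real number stored is the value of a walk or
  such an \<open>M\<close>, so its numerator and denominator stay polynomial in length.
\<close>

section \<open>Walks in weighted acyclic digraphs\<close>

text \<open>The optimum may be attained on any subgraph, including ones that cut \<open>s\<close>
  off from \<open>t\<close>. The facts about walks and agents therefore live in
  \<open>weighted_dag\<close>, which every spanning subgraph inherits, rather than in
  \<open>task_graph\<close>. The machine part has its own obstacle: adding two fractions can add up
  the lengths of both, so bounding sizes operation by operation along the run would allow a doubling
  with every relaxation. Sizes are instead read off the invariants, which tie each stored real to a
  single walk of fewer than \<open>n\<close> arcs. The verification is done over an abstract size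
  relation, so that one program and one polynomial serve both cost models.\<close>

locale weighted_dag = pair_fin_digraph G for G :: "'a pair_pre_digraph" +
  fixes c :: "'a \<times> 'a \<Rightarrow> real"
  assumes acyclic_arcs: "acyclic (parcs G)"
    and cost_nonneg: "\<And>e. e \<in> parcs G \<Longrightarrow> 0 \<le> c e"
begin

lemma awalk_trancl: "awalk u p v \<Longrightarrow> p \<noteq> [] \<Longrightarrow> (u, v) \<in> (parcs G)\<^sup>+"
proof (induction p arbitrary: u)
  case (Cons e p)
  then have e: "(u, snd e) \<in> parcs G" and p: "awalk (snd e) p v"
    by (auto simp: awalk_Cons_iff)
  show ?case
  proof (cases "p = []")
    case True
    with e p show ?thesis by (auto simp: awalk_Nil_iff)
  next
    case False
    with Cons.IH p have "(snd e, v) \<in> (parcs G)\<^sup>+" by blast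
    with e show ?thesis by (rule trancl_into_trancl2)
  qed
qed simp

lemma closed_awalk_Nil: "awalk u p u \<Longrightarrow> p = []"
  using awalk_trancl acyclic_arcs unfolding acyclic_def by blast

lemma awalk_imp_apath: "awalk u p v \<Longrightarrow> apath u p v"
proof (rule ccontr)
  assume p: "awalk u p v" "\<not> apath u p v"
  then have "\<not> distinct (awalk_verts u p)" by (simp add: apath_def)
  from awalk_not_distinct_decomp[OF p(1) this] obtain r w
    where "0 < length r" "awalk w r w" by blast
  with closed_awalk_Nil show False by blast
qed

lemma apath_iff_awalk: "apath u p v \<longleftrightarrow> awalk u p v"
  using awalk_imp_apath awalkI_apath by blast

lemma length_awalk_less: "awalk u p v \<Longrightarrow> length p < card (pverts G)"
  using length_apath_less awalk_imp_apath by blast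

lemma finite_awalks: "finite {p. awalk u p v}"
  using apaths_finite[of u v] by (simp add: apath_iff_awalk)

lemma awalk_cost_nonneg: "awalk u p v \<Longrightarrow> 0 \<le> awalk_cost c p"
  using pos_cost_pos_awalk_cost cost_nonneg by blast

lemma awalk_argmin:
  fixes f :: "('a \<times> 'a) awalk \<Rightarrow> 'b::linorder"
  assumes "awalk u q v"
  obtains p where "awalk u p v" "\<And>q. awalk u q v \<Longrightarrow> f p \<le> f q"
proof -
  have ne: "{p. awalk u p v} \<noteq> {}" using assms by auto
  from arg_min_if_finite[OF finite_awalks ne, of f] that show thesis
    by (metis mem_Collect_eq not_le_imp_less)
qed

lemma mu_attained:
  assumes "awalk u q v"
  obtains p where "awalk u p v" "\<mu> c u v = ereal (awalk_cost c p)"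
proof -
  obtain p where p: "awalk u p v" "\<And>q. awalk u q v \<Longrightarrow> awalk_cost c p \<le> awalk_cost c q"
    using awalk_argmin[OF assms, of "awalk_cost c"] by blast
  then have "\<mu> c u v = ereal (awalk_cost c p)"
    unfolding \<mu>_def by (intro antisym INF_lower INF_greatest) (auto intro: INF_lower2)
  with p that show thesis by blast
qed

lemma finite_out_neighbours: "finite {w. (v, w) \<in> parcs G}"
  by (rule finite_subset[OF _ finite_imageI[OF pair_finite_arcs, of snd]]) force

lemma zeta_attained:
  assumes "(v, w') \<in> parcs G"
  shows "\<exists>w. (v, w) \<in> parcs G \<and> ereal (c (v, w)) + ereal \<beta> * \<mu> c w t = zeta \<beta> G c t v"
proof -
  have ne: "{w. (v, w) \<in> parcs G} \<noteq> {}" using assms by auto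
  from finite_INF_in[OF finite_out_neighbours ne, of "\<lambda>w. ereal (c (v, w)) + ereal \<beta> * \<mu> c w t"]
  show ?thesis unfolding zeta_def by auto
qed

text \<open>Without such a rule \<open>motivating\<close> would hold vacuously; it turns the
  property into an actual run of the agent.\<close>

lemma tie_breaking_exists: "\<exists>\<sigma>. tie_breaking \<beta> G c t \<sigma>"
proof -
  have "\<forall>v. \<exists>w. (\<exists>w'. (v, w') \<in> parcs G) \<longrightarrow>
      (v, w) \<in> parcs G \<and> ereal (c (v, w)) + ereal \<beta> * \<mu> c w t = zeta \<beta> G c t v"
    using zeta_attained by blast
  from choice[OF this] show ?thesis unfolding tie_breaking_def by blast
qed

section \<open>What the agent's acceptance of a reward says about the costs of walks\<close>

lemma zeta_le_imp_arc:
  assumes "zeta \<beta> G c t v \<le> ereal r"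
  shows "\<exists>w. (v, w) \<in> parcs G"
proof (rule ccontr)
  assume "\<not> ?thesis"
  then have "zeta \<beta> G c t v = \<infinity>" by (simp add: zeta_def top_ereal_def)
  with assms show False by simp
qed

text \<open>Positivity of \<beta> makes an unreachable target visible: \<beta> times the infinite
  distance is infinite, whereas in \<open>ereal\<close> zero times infinity is zero.\<close>

lemma le_mu_imp_awalk:
  assumes "0 < \<beta>" "ereal x + ereal \<beta> * \<mu> c w t \<le> ereal r"
  obtains q where "awalk w q t" "x + \<beta> * awalk_cost c q \<le> r"
proof -
  have "\<mu> c w t \<noteq> \<infinity>"
    using assms by (auto simp: ereal_mult_infty)
  then have "\<exists>q. awalk w q t"
    using \<mu>_reach_conv[of c w t] by (auto simp: reachable_awalk less_top top_ereal_def)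
  then obtain q where "awalk w q t" "\<mu> c w t = ereal (awalk_cost c q)"
    using mu_attained by metis
  with assms(2) that show thesis by simp
qed

text \<open>The walk is the one that the agent follows. Each accepted \<zeta> is the cost of the
  chosen edge plus a non-negative discounted remainder, so the edge alone costs at most
  \<open>\<beta> * r\<close>.\<close>

lemma agent_reaches_imp_awalk:
  assumes "agent_reaches \<beta> G c t r \<sigma> v" "tie_breaking \<beta> G c t \<sigma>" "0 < \<beta>" "v \<in> pverts G"
  shows "\<exists>p. awalk v p t \<and> (\<forall>e\<in>set p. c e \<le> \<beta> * r)"
  using assms
proof (induction rule: agent_reaches.induct)
  case arrived
  then show ?case by (intro exI[of _ "[]"]) (simp add: awalk_Nil_iff)
next
  case (move v)
  then have arc: "(v, \<sigma> v) \<in> parcs G"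
      and "ereal (c (v, \<sigma> v)) + ereal \<beta> * \<mu> c (\<sigma> v) t = zeta \<beta> G c t v"
    using zeta_le_imp_arc[OF move.hyps(2)] unfolding tie_breaking_def by blast+
  with move.hyps have "ereal (c (v, \<sigma> v)) + ereal \<beta> * \<mu> c (\<sigma> v) t \<le> ereal (\<beta> * r)" by simp
  then obtain q where
    q: "awalk (\<sigma> v) q t" "c (v, \<sigma> v) + \<beta> * awalk_cost c q \<le> \<beta> * r"
    by (rule le_mu_imp_awalk[OF \<open>0 < \<beta>\<close>])
  have "0 \<le> \<beta> * awalk_cost c q"
    using awalk_cost_nonneg[OF q(1)] \<open>0 < \<beta>\<close> by simp
  with q(2) have "c (v, \<sigma> v) \<le> \<beta> * r" by linarith
  moreover obtain p where "awalk (\<sigma> v) p t" "\<forall>e\<in>set p. c e \<le> \<beta> * r"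
    using move in_arcsD2[OF arc] by blast
  ultimately show ?case
    using arc by (intro exI[of _ "(v, \<sigma> v) # p"]) (simp add: awalk_Cons_iff)
qed

lemma motivating_imp_awalk_le:
  assumes "motivating \<beta> G c s t r" "0 < \<beta>" "s \<in> pverts G"
  obtains p where "awalk s p t" "\<And>e. e \<in> set p \<Longrightarrow> c e \<le> \<beta> * r"
proof -
  obtain \<sigma> where \<sigma>: "tie_breaking \<beta> G c t \<sigma>" using tie_breaking_exists by blast
  with assms(1) have "agent_reaches \<beta> G c t r \<sigma> s" by (simp add: motivating_def)
  from agent_reaches_imp_awalk[OF this \<sigma> assms(2,3)] that show thesis by blast
qed

text \<open>Only the decision at \<open>s\<close> is used; \<open>s \<noteq> t\<close> ensures that
  there is one. The first edge enters \<zeta> undiscounted, and discounting it too only lowers the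
  value, so \<beta> factors out of the whole walk and cancels.\<close>

lemma motivating_imp_cost_le:
  assumes "motivating \<beta> G c s t r" "0 < \<beta>" "\<beta> < 1" "s \<noteq> t"
  obtains p where "awalk s p t" "awalk_cost c p \<le> r"
proof -
  obtain \<sigma> where \<sigma>: "tie_breaking \<beta> G c t \<sigma>" using tie_breaking_exists by blast
  with assms have "agent_reaches \<beta> G c t r \<sigma> s" by (simp add: motivating_def)
  then have le: "zeta \<beta> G c t s \<le> ereal (\<beta> * r)"
    using \<open>s \<noteq> t\<close> by (auto elim: agent_reaches.cases)
  obtain w where w: "(s, w) \<in> parcs G" "ereal (c (s, w)) + ereal \<beta> * \<mu> c w t = zeta \<beta> G c t s"
    using zeta_le_imp_arc[OF le] zeta_attained by blast
  with le have "ereal (c (s, w)) + ereal \<beta> * \<mu> c w t \<le> ereal (\<beta> * r)" by simp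
  then obtain q where q: "awalk w q t" "c (s, w) + \<beta> * awalk_cost c q \<le> \<beta> * r"
    by (rule le_mu_imp_awalk[OF \<open>0 < \<beta>\<close>])
  have "\<beta> * c (s, w) \<le> c (s, w)"
    using cost_nonneg[OF w(1)] \<open>\<beta> < 1\<close> mult_right_mono[of \<beta> 1 "c (s, w)"] by simp
  with q have "\<beta> * awalk_cost c ((s, w) # q) \<le> \<beta> * r"
    by (simp add: distrib_left)
  then have "awalk_cost c ((s, w) # q) \<le> r" using \<open>0 < \<beta>\<close> by simp
  moreover have "awalk s ((s, w) # q) t" using w q by (simp add: awalk_Cons_iff)
  ultimately show thesis using that by blast
qed

end

section \<open>Passing to spanning subgraphs\<close>

lemma weighted_dag_of_task_graph: "task_graph G c s t \<Longrightarrow> weighted_dag G c"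
  unfolding task_graph_def task_graph_axioms_def weighted_dag_def weighted_dag_axioms_def by blast

lemma weighted_dag_spanning:
  assumes "weighted_dag G c" "spanning (with_proj H) (with_proj G)"
  shows "weighted_dag H c" "pverts H = pverts G" "parcs H \<subseteq> parcs G"
proof -
  interpret weighted_dag G c by fact
  have sub: "subgraph (with_proj H) (with_proj G)" and [simp]: "pverts H = pverts G"
    using assms(2) by (auto simp: spanning_def)
  from sub have arcs: "parcs H \<subseteq> parcs G" by (simp add: subgraph_def)
  show "weighted_dag H c"
  proof
    fix e assume "e \<in> parcs H"
    with arcs have "e \<in> parcs G" by blast
    then show "fst e \<in> pverts H" "snd e \<in> pverts H" "0 \<le> c e"
      using arc_fst_in_verts[of e] arc_snd_in_verts[of e] cost_nonneg[of e] by simp_all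
  next
    show "finite (pverts H)" by (simp add: pair_finite_verts)
    show "finite (parcs H)" using arcs pair_finite_arcs by (rule finite_subset)
    show "acyclic (parcs H)" using acyclic_arcs arcs by (rule acyclic_subset)
  qed
  show "pverts H = pverts G" "parcs H \<subseteq> parcs G" by fact+
qed

lemma (in weighted_dag) spanningI:
  assumes "pverts H = pverts G" "parcs H \<subseteq> parcs G"
  shows "spanning (with_proj H) (with_proj G)"
  unfolding spanning_def subgraph_def using assms
  by (auto simp: compatible_def wf_digraph_def wellformed' arc_fst_in_verts arc_snd_in_verts)

lemma (in weighted_dag) awalk_spanning:
  assumes "spanning (with_proj H) (with_proj G)" "pre_digraph.awalk (with_proj H) u p v"
  shows "awalk u p v"
  using assms by (auto simp: pre_digraph.awalk_def spanning_def subgraph_def cas_with_proj_eq)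


section \<open>Path graphs\<close>

text \<open>The largest \<zeta> on a path graph, as a real number and by recursion over suffixes.
  For non-negative costs the starting value 0 never exceeds a genuine \<zeta>; on the empty path it
  agrees with the reward 0 that \<open>path_reward\<close> gives when \<open>s = t\<close>.\<close>

primrec path_zeta :: "real \<Rightarrow> ('e \<Rightarrow> real) \<Rightarrow> 'e list \<Rightarrow> real" where
  "path_zeta \<beta> c [] = 0"
| "path_zeta \<beta> c (e # p) = max (c e + \<beta> * sum_list (map c p)) (path_zeta \<beta> c p)"

lemma path_zeta_nonneg: "0 \<le> path_zeta \<beta> c p"
  by (induction p) auto

text \<open>A new last edge raises every earlier \<zeta> by \<open>\<beta> * c e\<close> and has
  \<open>c e\<close> as its own. The starting value 0 is shifted as well, and \<beta> \<le> 1 lets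
  \<open>c e\<close> absorb it.\<close>

lemma path_zeta_snoc:
  assumes "0 \<le> \<beta>" "\<beta> \<le> 1" "0 \<le> c e"
  shows "path_zeta \<beta> c (p @ [e]) = max (path_zeta \<beta> c p + \<beta> * c e) (c e)"
proof -
  have "\<beta> * c e \<le> c e" "0 \<le> \<beta> * c e"
    using assms mult_right_mono[of \<beta> 1 "c e"] by auto
  then show ?thesis by (induction p) (auto simp: max_def algebra_simps)
qed

lemma path_zeta_le_sum:
  assumes "\<forall>e\<in>set p. 0 \<le> c e" "\<beta> \<le> 1"
  shows "path_zeta \<beta> c p \<le> sum_list (map c p)"
  using assms
proof (induction p)
  case (Cons e p)
  have "0 \<le> sum_list (map c p)" using Cons.prems by (intro sum_list_nonneg) auto
  with Cons show ?case using mult_right_mono[of \<beta> 1 "sum_list (map c p)"] by auto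
qed simp

lemma path_zeta_le_bound:
  assumes "\<forall>e\<in>set p. c e \<le> b" "0 \<le> \<beta>" "0 \<le> b"
  shows "path_zeta \<beta> c p \<le> b * (1 + \<beta> * length p)"
  using assms
proof (induction p)
  case (Cons e p)
  have "sum_list (map c p) \<le> b * length p"
    using Cons.prems by (induction p) (auto simp: algebra_simps)
  from mult_left_mono[OF this \<open>0 \<le> \<beta>\<close>]
  have "\<beta> * sum_list (map c p) \<le> b * \<beta> * length p" by (simp add: algebra_simps)
  moreover have "0 \<le> b * \<beta>" using Cons.prems by simp
  moreover have "path_zeta \<beta> c p \<le> b * (1 + \<beta> * length p)" "c e \<le> b"
    using Cons by auto
  ultimately show ?case by (simp add: algebra_simps)
qed simp

locale path_graph = weighted_dag G c for G :: "'a pair_pre_digraph" and c +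
  fixes s t :: 'a and P :: "('a \<times> 'a) awalk" and H :: "'a pair_pre_digraph"
  assumes path: "apath s P t"
    and H_def: "H = \<lparr>pverts = pverts G, parcs = set P\<rparr>"
begin

lemma pverts_H [simp]: "pverts H = pverts G" and parcs_H [simp]: "parcs H = set P"
  by (simp_all add: H_def)

lemma spanning_H: "spanning (with_proj H) (with_proj G)"
  using path by (intro spanningI) (auto simp: apath_def awalk_def)

sublocale H: weighted_dag H c
  using weighted_dag_spanning(1)[OF _ spanning_H] by (simp add: weighted_dag_axioms)

text \<open>This is what deprives the agent of choice: each vertex has at most one edge out, and a
  walk to \<open>t\<close> cannot stop before the end of the path.\<close>

lemma distinct_tails: "distinct (map fst P)" "t \<notin> fst ` set P"
proof -
  have *: "distinct (awalk_verts s P)" "awalk_verts s P \<noteq> []" "awlast s P = t"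
    using path by (auto simp: apath_def)
  then show "distinct (map fst P)" "t \<notin> fst ` set P"
    by (auto simp: awalk_verts_conv split: if_splits)
qed

lemma out_arc_unique: "(v, w) \<in> set P \<Longrightarrow> (v, w') \<in> set P \<Longrightarrow> w' = w"
  using distinct_tails(1) by (metis eq_key_imp_eq_value)

lemma awalk_H_unique: "H.awalk v p t \<Longrightarrow> H.awalk v q t \<Longrightarrow> q = p"
proof (induction p arbitrary: v q)
  case Nil
  then have "v = t" using H.awalk_empty_ends by blast
  with Nil.prems(2) H.closed_awalk_Nil show ?case by blast
next
  case (Cons e p)
  then have e: "e \<in> set P" "v = fst e" "H.awalk (snd e) p t"
    by (auto simp: H.awalk_Cons_iff)
  with distinct_tails(2) have "v \<noteq> t" by auto
  with Cons.prems obtain e' q' where q: "q = e' # q'"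
    by (cases q) (auto simp: H.awalk_Nil_iff)
  with Cons.prems have e': "e' \<in> set P" "v = fst e'" "H.awalk (snd e') q' t"
    by (auto simp: H.awalk_Cons_iff)
  with e out_arc_unique have "e' = e" by (metis prod.collapse)
  with Cons.IH e e' q show ?case by auto
qed

lemma zeta_H:
  assumes "H.awalk v (e # p) t"
  shows "zeta \<beta> H c t v = ereal (c e + \<beta> * awalk_cost c p)"
proof -
  have e: "e \<in> set P" "v = fst e" and p: "H.awalk (snd e) p t"
    using assms by (auto simp: H.awalk_Cons_iff)
  then have "{w. (v, w) \<in> parcs H} = {snd e}" using out_arc_unique
    by auto (metis prod.collapse)
  moreover have "H.\<mu> c (snd e) t = ereal (awalk_cost c p)"
    using awalk_H_unique[OF p] by (auto intro: H.mu_attained[OF p])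
  ultimately show ?thesis using e by (simp add: zeta_def)
qed

text \<open>Stated for every suffix of the path so that the induction goes through. The suffix is
  nonempty because a supremum over no vertices is -\<infinity>, while \<open>path_zeta\<close>
  starts at 0.\<close>

lemma SUP_zeta_H:
  assumes "H.awalk v p t" "p \<noteq> []" "0 \<le> \<beta>"
  shows "(SUP v\<in>fst ` set p. zeta \<beta> H c t v) = ereal (path_zeta \<beta> c p)"
  using assms
proof (induction p arbitrary: v)
  case (Cons e p)
  have e: "e \<in> set P" "v = fst e" and p: "H.awalk (snd e) p t"
    using Cons.prems by (auto simp: H.awalk_Cons_iff)
  have z: "zeta \<beta> H c t v = ereal (c e + \<beta> * sum_list (map c p))"
    using zeta_H[OF Cons.prems(1)] by (simp add: awalk_cost_def)
  have nonneg: "0 \<le> c e" "0 \<le> \<beta> * sum_list (map c p)"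
    using H.cost_nonneg[of e] e H.awalk_cost_nonneg[OF p] \<open>0 \<le> \<beta>\<close>
    by (auto simp: awalk_cost_def)
  show ?case
  proof (cases "p = []")
    case True
    with z e nonneg show ?thesis by (simp add: max_def bot_ereal_def)
  next
    case False
    with Cons.IH[OF p] \<open>0 \<le> \<beta>\<close> z e show ?thesis by (simp add: sup_max)
  qed
qed simp

lemma path_reward_H:
  assumes "0 < \<beta>"
  shows "path_reward \<beta> H c s t P = path_zeta \<beta> c P / \<beta>"
proof (cases "P = []")
  case True
  then have "s = t" using path by (simp add: apath_Nil_iff)
  with True show ?thesis by (simp add: path_reward_def bot_ereal_def)
next
  case False
  have walk: "H.awalk s P t"
    using path by (auto simp: apath_def awalk_def H.awalk_def)
  have "set (pawalk_verts s P) - {t} = fst ` set P"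
  proof -
    have "awalk_verts s P = map fst P @ [t]"
      using False path awalk_verts_conv[of s P] by (auto simp: apath_def)
    then show ?thesis using distinct_tails(2) by auto
  qed
  with SUP_zeta_H[OF walk False] assms show ?thesis
    by (simp add: path_reward_def)
qed

lemma zeta_le_path_zeta:
  assumes "v \<in> fst ` set P" "0 \<le> \<beta>"
  shows "zeta \<beta> H c t v \<le> ereal (path_zeta \<beta> c P)"
proof -
  have walk: "H.awalk s P t"
    using path by (auto simp: apath_def awalk_def H.awalk_def)
  have "P \<noteq> []" using assms(1) by auto
  from SUP_zeta_H[OF walk this assms(2)] SUP_upper[OF assms(1)] show ?thesis by metis
qed

lemma motivating_H:
  assumes "0 < \<beta>"
  shows "motivating \<beta> H c s t (path_zeta \<beta> c P / \<beta>)"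
  unfolding motivating_def
proof (intro allI impI)
  fix \<sigma> assume \<sigma>: "tie_breaking \<beta> H c t \<sigma>"
  have "agent_reaches \<beta> H c t (path_zeta \<beta> c P / \<beta>) \<sigma> v" if "H.awalk v p t" for p v
    using that
  proof (induction p arbitrary: v)
    case Nil
    then show ?case by (auto simp: H.awalk_Nil_iff agent_reaches.arrived)
  next
    case (Cons e p)
    then have e: "e \<in> set P" "v = fst e" and p: "H.awalk (snd e) p t"
      by (auto simp: H.awalk_Cons_iff)
    then have "(v, snd e) \<in> parcs H" by simp
    with \<sigma> have "(v, \<sigma> v) \<in> parcs H" unfolding tie_breaking_def by blast
    with \<open>(v, snd e) \<in> parcs H\<close> out_arc_unique have "\<sigma> v = snd e" by auto
    moreover have "v \<noteq> t" using e distinct_tails(2) by auto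
    moreover have "zeta \<beta> H c t v \<le> ereal (\<beta> * (path_zeta \<beta> c P / \<beta>))"
      using zeta_le_path_zeta[of v \<beta>] e assms by simp
    ultimately show ?case using Cons.IH[OF p] by (simp add: agent_reaches.move)
  qed
  moreover have "H.awalk s P t"
    using path by (auto simp: apath_def awalk_def H.awalk_def)
  ultimately show "agent_reaches \<beta> H c t (path_zeta \<beta> c P / \<beta>) \<sigma> s" by blast
qed

end

lemma path_graphI:
  "weighted_dag G c \<Longrightarrow> pre_digraph.apath (with_proj G) s P t \<Longrightarrow>
    path_graph G c s t P \<lparr>pverts = pverts G, parcs = set P\<rparr>"
  by (simp add: path_graph_def path_graph_axioms_def)

lemma path_output_iff:
  assumes "weighted_dag G c" "pre_digraph.apath (with_proj G) s P t" "0 < \<beta>"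
  shows "path_output \<beta> G c s t P H r \<longleftrightarrow>
    H = \<lparr>pverts = pverts G, parcs = set P\<rparr> \<and> r = path_zeta \<beta> c P / \<beta>"
  using path_graph.path_reward_H[OF path_graphI[OF assms(1,2)] assms(3)]
  unfolding path_output_def by auto


section \<open>Existence of the optimal reward\<close>

text \<open>The agent consults \<open>r\<close> only through the test \<zeta> \<le>
  \<open>\<beta> * r\<close>, so a reward passing every test that \<open>r\<close> passes motivates
  as well.\<close>

lemma motivating_threshold:
  assumes "motivating \<beta> H c s t r"
    and "\<And>v. zeta \<beta> H c t v \<le> ereal (\<beta> * r) \<Longrightarrow> zeta \<beta> H c t v \<le> ereal (\<beta> * r')"
  shows "motivating \<beta> H c s t r'"
proof -
  have "agent_reaches \<beta> H c t r' \<sigma> v" if "agent_reaches \<beta> H c t r \<sigma> v" for \<sigma> v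
    using that by induction (auto intro: agent_reaches.intros assms(2))
  with assms(1) show ?thesis unfolding motivating_def by blast
qed

lemma (in weighted_dag) zeta_finite_values:
  "finite {z. \<exists>v. zeta \<beta> G c t v = ereal z}"
proof -
  have "{z. \<exists>v. zeta \<beta> G c t v = ereal z} \<subseteq> real_of_ereal ` zeta \<beta> G c t ` pverts G"
  proof clarify
    fix z v assume z: "zeta \<beta> G c t v = ereal z"
    \<comment> \<open>Outside the vertex set there are no out-edges, so \<zeta> is infinite
      there.\<close>
    then have "v \<in> pverts G" using zeta_le_imp_arc[of \<beta> t v z] in_arcsD1 by auto
    with z show "z \<in> real_of_ereal ` zeta \<beta> G c t ` pverts G"
      by (metis imageI real_of_ereal.simps(1))
  qed
  then show ?thesis by (rule finite_subset) (simp add: pair_finite_verts)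
qed

lemma (in weighted_dag) ms_opt_exists:
  assumes "feasible_reward \<beta> G c s t r0" "0 < \<beta>"
  shows "\<exists>r. ms_opt \<beta> G c s t r"
proof -
  define S where "S = {H. spanning (with_proj H) (with_proj G)}"
  \<comment> \<open>\<open>Z\<close> collects the rewards at which an acceptance test in some
    subgraph switches; 0 is added so that a reward below all of them can still be rounded
    down.\<close>
  define Z where "Z = insert 0 (\<Union>H\<in>S. (\<lambda>z. z / \<beta>) ` {z. \<exists>v. zeta \<beta> H c t v = ereal z})"
  have dag: "weighted_dag H c" "pverts H = pverts G" "parcs H \<subseteq> parcs G" if "H \<in> S" for H
    using weighted_dag_spanning[OF weighted_dag_axioms, of H] that by (auto simp: S_def)
  have "S \<subseteq> (\<lambda>A. \<lparr>pverts = pverts G, parcs = A\<rparr>) ` Pow (parcs G)"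
  proof
    fix H assume "H \<in> S"
    with dag(2,3)[OF this] show "H \<in> (\<lambda>A. \<lparr>pverts = pverts G, parcs = A\<rparr>) ` Pow (parcs G)"
      by (intro image_eqI[where x = "parcs H"]) auto
  qed
  then have "finite S" by (rule finite_subset) (simp add: pair_finite_arcs)
  then have finZ: "finite Z"
    using weighted_dag.zeta_finite_values[OF dag(1)] by (simp add: Z_def)
  \<comment> \<open>Rounding a feasible reward down to the nearest element of \<open>Z\<close> keeps
    every passed test passed, so the minimum may be sought within \<open>Z\<close>.\<close>
  have down: "\<exists>r'\<in>Z. r' \<le> r \<and> feasible_reward \<beta> G c s t r'" if r: "feasible_reward \<beta> G c s t r" for r
  proof -
    obtain H where H: "H \<in> S" "motivating \<beta> H c s t r" and "0 \<le> r"
      using r by (auto simp: feasible_reward_def S_def)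
    define r' where "r' = Max {z \<in> Z. z \<le> r}"
    have fin: "finite {z \<in> Z. z \<le> r}" using finZ by simp
    have ne: "{z \<in> Z. z \<le> r} \<noteq> {}" "0 \<in> {z \<in> Z. z \<le> r}" using \<open>0 \<le> r\<close> by (auto simp: Z_def)
    have r': "r' \<in> Z" "r' \<le> r" "0 \<le> r'"
      using Max_in[OF fin ne(1)] Max_ge[OF fin ne(2)] by (auto simp: r'_def)
    have "motivating \<beta> H c s t r'"
    proof (rule motivating_threshold[OF H(2)])
      fix v assume le: "zeta \<beta> H c t v \<le> ereal (\<beta> * r)"
      show "zeta \<beta> H c t v \<le> ereal (\<beta> * r')"
      proof (cases "zeta \<beta> H c t v")
        case (real z)
        then have "z / \<beta> \<in> Z" using H(1) by (auto simp: Z_def)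
        moreover have "z / \<beta> \<le> r" using le real \<open>0 < \<beta>\<close> by (simp add: field_simps)
        ultimately have "z / \<beta> \<le> r'" unfolding r'_def by (intro Max_ge[OF fin]) simp
        with real \<open>0 < \<beta>\<close> show ?thesis by (simp add: field_simps)
      qed (use le in auto)
    qed
    with H(1) r' show ?thesis by (auto simp: feasible_reward_def S_def)
  qed
  define F where "F = {z \<in> Z. feasible_reward \<beta> G c s t z}"
  have F: "finite F" "F \<noteq> {}" using finZ down[OF assms(1)] by (auto simp: F_def)
  have "ms_opt \<beta> G c s t (Min F)"
    unfolding ms_opt_def
  proof (intro conjI allI impI)
    show "feasible_reward \<beta> G c s t (Min F)" using Min_in[OF F] by (simp add: F_def)
    fix r assume "feasible_reward \<beta> G c s t r"
    from down[OF this] obtain r' where "r' \<in> F" "r' \<le> r" by (auto simp: F_def)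
    with Min_le[OF F(1)] show "Min F \<le> r" by force
  qed
  then show ?thesis by blast
qed


section \<open>Approximation ratio\<close>

text \<open>Each \<zeta> on \<open>P\<close> is one undiscounted edge, at most
  \<open>\<beta> * r\<close>, plus a discounted remainder of at most \<open>n\<close> such edges.
  Divided by \<beta>, the former gives the 1 of the ratio and the latter \<open>\<beta> * n\<close>,
  which the case condition keeps within \<open>sqrt n\<close>.\<close>

lemma (in weighted_dag) minmax_path_ratio:
  assumes P: "minmax_path G c s t P" and r: "feasible_reward \<beta> G c s t r"
    and \<beta>: "0 < \<beta>" "\<beta> \<le> 1 / sqrt (card (pverts G))"
  shows "path_zeta \<beta> c P / \<beta> \<le> (1 + sqrt (card (pverts G))) * r"
proof -
  let ?n = "card (pverts G)"
  obtain H where H: "spanning (with_proj H) (with_proj G)" "motivating \<beta> H c s t r" and "0 \<le> r"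
    using r by (auto simp: feasible_reward_def)
  interpret H: weighted_dag H c using weighted_dag_spanning[OF weighted_dag_axioms H(1)] by simp
  have walk: "awalk s P t" using P by (auto simp: minmax_path_def apath_def)
  then have "s \<in> pverts H" using weighted_dag_spanning[OF weighted_dag_axioms H(1)] by auto
  then obtain q where q: "H.awalk s q t" "\<And>e. e \<in> set q \<Longrightarrow> c e \<le> \<beta> * r"
    using H.motivating_imp_awalk_le[OF H(2) \<beta>(1)] by blast
  have qG: "awalk s q t" using awalk_spanning[OF H(1) q(1)] .
  have max_le: "Max (c ` set P) \<le> Max (c ` set q)"
    using P qG by (auto simp: minmax_path_def apath_iff_awalk)
  have le: "c e \<le> \<beta> * r" if e: "e \<in> set P" for e
  proof -
    have "P \<noteq> []" using e by auto
    \<comment> \<open>A nonempty \<open>P\<close> rules out \<open>s = t\<close>, so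
      \<open>q\<close> is nonempty too and \<open>Max\<close> over its costs is meaningful.\<close>
    then have "q \<noteq> []" using walk qG closed_awalk_Nil awalk_empty_ends by blast
    then have "Max (c ` set q) \<le> \<beta> * r" using q(2) by auto
    moreover have "c e \<le> Max (c ` set P)" using e by simp
    ultimately show ?thesis using max_le by linarith
  qed
  have n: "0 < ?n" "length P \<le> ?n"
    using length_awalk_less[OF walk] by auto
  have "\<beta> * length P \<le> \<beta> * ?n" using n \<beta> by simp
  also have "\<dots> \<le> 1 / sqrt ?n * ?n" using \<beta> by (intro mult_right_mono) auto
  also have "\<dots> = sqrt ?n" using n by (simp add: real_div_sqrt)
  finally have len: "\<beta> * length P \<le> sqrt ?n" .
  have "path_zeta \<beta> c P \<le> \<beta> * r * (1 + \<beta> * length P)"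
    using le \<open>0 \<le> r\<close> \<beta> by (intro path_zeta_le_bound) auto
  also have "\<dots> \<le> \<beta> * r * (1 + sqrt ?n)"
    using len \<open>0 \<le> r\<close> \<beta> by (intro mult_left_mono) auto
  finally show ?thesis using \<beta> by (simp add: field_simps)
qed

lemma (in weighted_dag) cheapest_path_ratio:
  assumes P: "cheapest_path G c s t P" and r: "feasible_reward \<beta> G c s t r"
    and \<beta>: "0 < \<beta>" "\<beta> < 1" "1 / sqrt (card (pverts G)) \<le> \<beta>"
  shows "path_zeta \<beta> c P / \<beta> \<le> (1 + sqrt (card (pverts G))) * r"
proof -
  let ?n = "card (pverts G)"
  obtain H where H: "spanning (with_proj H) (with_proj G)" "motivating \<beta> H c s t r" and "0 \<le> r"
    using r by (auto simp: feasible_reward_def)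
  interpret H: weighted_dag H c using weighted_dag_spanning[OF weighted_dag_axioms H(1)] by simp
  have walk: "awalk s P t" using P by (auto simp: cheapest_path_def apath_def)
  have n: "0 < ?n" using length_awalk_less[OF walk] by auto
  \<comment> \<open>If \<open>s = t\<close>, the agent decides nothing and its motivation carries no
    information on costs; then the path is empty.\<close>
  have cost: "awalk_cost c P \<le> r"
  proof (cases "s = t")
    case True
    with walk closed_awalk_Nil have "P = []" by blast
    with \<open>0 \<le> r\<close> show ?thesis by simp
  next
    case False
    obtain q where q: "H.awalk s q t" "awalk_cost c q \<le> r"
      using H.motivating_imp_cost_le[OF H(2) \<beta>(1,2) False] by blast
    have "awalk s q t" using awalk_spanning[OF H(1) q(1)] .
    with P q(2) show ?thesis by (force simp: cheapest_path_def apath_iff_awalk)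
  qed
  have "path_zeta \<beta> c P \<le> awalk_cost c P"
    using walk cost_nonneg \<beta> unfolding awalk_cost_def awalk_def
    by (intro path_zeta_le_sum) (blast, simp)
  with cost have "path_zeta \<beta> c P / \<beta> \<le> r / \<beta>" using \<beta> by (simp add: divide_right_mono)
  also have "r / \<beta> = (1 / \<beta>) * r" by simp
  also have "\<dots> \<le> sqrt ?n * r"
    using \<beta> n \<open>0 \<le> r\<close> by (intro mult_right_mono) (auto simp: field_simps)
  also have "\<dots> \<le> (1 + sqrt ?n) * r" using \<open>0 \<le> r\<close> by (intro mult_right_mono) auto
  finally show ?thesis .
qed

lemma combined_approx_correct:
  assumes "task_graph G c s t" "0 < \<beta>" "\<beta> < 1" "combined_approx \<beta> G c s t H r"
  shows "spanning (with_proj H) (with_proj G) \<and> 0 \<le> r \<and> motivating \<beta> H c s t r \<and>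
    (\<exists>ropt. ms_opt \<beta> G c s t ropt \<and> r \<le> (1 + sqrt (real (card (pverts G)))) * ropt)"
proof -
  interpret weighted_dag G c using assms(1) by (rule weighted_dag_of_task_graph)
  let ?n = "card (pverts G)"
  let ?minmax = "\<beta> \<le> 1 / sqrt (real ?n)"
  obtain P where path: "path_output \<beta> G c s t P H r"
    and P: "if ?minmax then minmax_path G c s t P else cheapest_path G c s t P"
    using assms(4) by (auto simp: combined_approx_def minmax_path_approx_def
        cheapest_path_approx_def split: if_splits)
  then have "apath s P t" by (auto simp: minmax_path_def cheapest_path_def split: if_splits)
  note pg = path_graphI[OF weighted_dag_axioms this]
  have H: "H = \<lparr>pverts = pverts G, parcs = set P\<rparr>" and r: "r = path_zeta \<beta> c P / \<beta>"
    using path_output_iff[OF weighted_dag_axioms \<open>apath s P t\<close> assms(2)] path by auto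
  have span: "spanning (with_proj H) (with_proj G)"
    using path_graph.spanning_H[OF pg] H by simp
  have "0 \<le> r" using path_zeta_nonneg[of \<beta> c P] assms(2) by (simp add: r)
  moreover have mot: "motivating \<beta> H c s t r"
    using path_graph.motivating_H[OF pg assms(2)] H r by simp
  \<comment> \<open>The algorithm's own output is the feasible reward from which the existence of an
    optimum starts.\<close>
  ultimately have "feasible_reward \<beta> G c s t r" using span by (auto simp: feasible_reward_def)
  then obtain ropt where ropt: "ms_opt \<beta> G c s t ropt" using ms_opt_exists assms(2) by blast
  then have feas: "feasible_reward \<beta> G c s t ropt" by (simp add: ms_opt_def)
  have "r \<le> (1 + sqrt (real ?n)) * ropt"
  proof (cases ?minmax)
    case True
    with P minmax_path_ratio[OF _ feas] assms r show ?thesis by simp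
  next
    case False
    with P cheapest_path_ratio[OF _ feas] assms r show ?thesis by simp
  qed
  with ropt mot span \<open>0 \<le> r\<close> show ?thesis by blast
qed

lemma combined_approx_exists:
  assumes "task_graph G c s t"
  shows "\<exists>H r. combined_approx \<beta> G c s t H r"
proof -
  interpret weighted_dag G c using assms by (rule weighted_dag_of_task_graph)
  obtain q where q: "awalk s q t"
    using task_graph.target_reachable[OF assms] by (auto simp: reachable_awalk)
  obtain P where "awalk s P t" "\<And>q. awalk s q t \<Longrightarrow> Max (c ` set P) \<le> Max (c ` set q)"
    using awalk_argmin[OF q, of "\<lambda>p. Max (c ` set p)"] by blast
  then have "minmax_path G c s t P" by (simp add: minmax_path_def apath_iff_awalk)
  moreover obtain P' where "awalk s P' t" "\<And>q. awalk s q t \<Longrightarrow> awalk_cost c P' \<le> awalk_cost c q"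
    using awalk_argmin[OF q, of "awalk_cost c"] by blast
  then have "cheapest_path G c s t P'" by (simp add: cheapest_path_def apath_iff_awalk)
  ultimately show ?thesis
    unfolding combined_approx_def minmax_path_approx_def cheapest_path_approx_def path_output_def
    by (metis (full_types))
qed


section \<open>Static cost bounds for programs\<close>

text \<open>Values may stand in for bit lengths: the natural cells hold only vertices, counters,
  flags and marks, whose values are already polynomial in the input size. \<open>NSub\<close> is
  truncated, hence bounded by its left operand.\<close>

primrec nbound :: "nexp \<Rightarrow> nat \<Rightarrow> nat" where
  "nbound (NConst k) K = k"
| "nbound (NMem a) K = K"
| "nbound (NAdd a b) K = nbound a K + nbound b K"
| "nbound (NSub a b) K = nbound a K"
| "nbound (NMul a b) K = nbound a K * nbound b K"

primrec ncost_bound :: "nexp \<Rightarrow> nat \<Rightarrow> nat" where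
  "ncost_bound (NConst k) K = k + 1"
| "ncost_bound (NMem a) K = ncost_bound a K + (K + 1)"
| "ncost_bound (NAdd a b) K = ncost_bound a K + ncost_bound b K + (nbound (NAdd a b) K + 1)"
| "ncost_bound (NSub a b) K = ncost_bound a K + ncost_bound b K + (nbound (NSub a b) K + 1)"
| "ncost_bound (NMul a b) K = ncost_bound a K + ncost_bound b K + (nbound (NMul a b) K + 1)"

text \<open>This bounds the size, not the value, so multiplication and division also just add the
  sizes of their operands plus one.\<close>

primrec rbound :: "rexp \<Rightarrow> nat \<Rightarrow> nat" where
  "rbound (RNat a) K = nbound a K"
| "rbound (RMem a) K = K"
| "rbound (RAdd a b) K = rbound a K + rbound b K + 1"
| "rbound (RSub a b) K = rbound a K + rbound b K + 1"
| "rbound (RMul a b) K = rbound a K + rbound b K + 1"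
| "rbound (RDiv a b) K = rbound a K + rbound b K + 1"

primrec rcost_bound :: "rexp \<Rightarrow> nat \<Rightarrow> nat" where
  "rcost_bound (RNat a) K = ncost_bound a K + (2 * rbound (RNat a) K + 6)"
| "rcost_bound (RMem a) K = ncost_bound a K + (2 * K + 6)"
| "rcost_bound (RAdd a b) K = rcost_bound a K + rcost_bound b K + (2 * rbound (RAdd a b) K + 6)"
| "rcost_bound (RSub a b) K = rcost_bound a K + rcost_bound b K + (2 * rbound (RSub a b) K + 6)"
| "rcost_bound (RMul a b) K = rcost_bound a K + rcost_bound b K + (2 * rbound (RMul a b) K + 6)"
| "rcost_bound (RDiv a b) K = rcost_bound a K + rcost_bound b K + (2 * rbound (RDiv a b) K + 6)"

primrec bcost_bound :: "bexp \<Rightarrow> nat \<Rightarrow> nat" where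
  "bcost_bound (NLe a b) K = ncost_bound a K + ncost_bound b K + 1"
| "bcost_bound (RLe a b) K = rcost_bound a K + rcost_bound b K + 1"
| "bcost_bound (BNot p) K = bcost_bound p K + 1"
| "bcost_bound (BAnd p q) K = bcost_bound p K + bcost_bound q K + 1"

text \<open>
  One number \<open>K\<close> bounds the natural cells, the sizes of the real cells, and the number of
  iterations of every single execution of a loop.
\<close>

primrec ccost_bound :: "com \<Rightarrow> nat \<Rightarrow> nat" where
  "ccost_bound Skip K = 1"
| "ccost_bound (NStore a e) K = ncost_bound a K + ncost_bound e K + 1"
| "ccost_bound (RStore a e) K = ncost_bound a K + rcost_bound e K + 1"
| "ccost_bound (Seq C D) K = ccost_bound C K + ccost_bound D K"
| "ccost_bound (Cond b C D) K = bcost_bound b K + (ccost_bound C K + ccost_bound D K)"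
| "ccost_bound (Loop b C) K = K * (bcost_bound b K + ccost_bound C K) + bcost_bound b K"

definition is_poly :: "(nat \<Rightarrow> nat) \<Rightarrow> bool" where
  "is_poly f \<longleftrightarrow> (\<exists>p. \<forall>x. f x = poly p x)"

lemma is_poly_const: "is_poly (\<lambda>_. k)"
  unfolding is_poly_def by (intro exI[of _ "[:k:]"]) simp

lemma is_poly_id: "is_poly (\<lambda>x. x)"
  unfolding is_poly_def by (intro exI[of _ "[:0, 1:]"]) simp

lemma is_poly_add: "is_poly f \<Longrightarrow> is_poly g \<Longrightarrow> is_poly (\<lambda>x. f x + g x)"
  unfolding is_poly_def by (metis poly_add)

lemma is_poly_mult: "is_poly f \<Longrightarrow> is_poly g \<Longrightarrow> is_poly (\<lambda>x. f x * g x)"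
  unfolding is_poly_def by (metis poly_mult)

lemmas is_poly_intros = is_poly_const is_poly_id is_poly_add is_poly_mult

context
  fixes K :: "nat \<Rightarrow> nat"
  assumes K: "is_poly K"
begin

lemma is_poly_nbound: "is_poly (\<lambda>x. nbound e (K x))"
  by (induction e) (auto intro!: is_poly_intros K)

lemma is_poly_ncost_bound: "is_poly (\<lambda>x. ncost_bound e (K x))"
  by (induction e) (auto simp only: ncost_bound.simps intro!: is_poly_intros is_poly_nbound K)

lemma is_poly_rbound: "is_poly (\<lambda>x. rbound e (K x))"
  by (induction e) (auto simp only: rbound.simps intro!: is_poly_intros is_poly_nbound K)

lemma is_poly_rcost_bound: "is_poly (\<lambda>x. rcost_bound e (K x))"
  by (induction e)
    (auto simp only: rcost_bound.simps intro!: is_poly_intros is_poly_rbound is_poly_ncost_bound K)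

lemma is_poly_bcost_bound: "is_poly (\<lambda>x. bcost_bound b (K x))"
  by (induction b)
    (auto simp only: bcost_bound.simps intro!: is_poly_intros is_poly_rcost_bound is_poly_ncost_bound)

text \<open>The program is fixed, so its constants stay constants and each loop level contributes
  one factor \<open>K\<close>. \<open>Cond\<close> adds both branches because a maximum would lead
  out of the polynomials.\<close>

lemma is_poly_ccost_bound: "is_poly (\<lambda>x. ccost_bound C (K x))"
  by (induction C)
    (auto simp only: ccost_bound.simps
      intro!: is_poly_intros is_poly_bcost_bound is_poly_rcost_bound is_poly_ncost_bound K)

end

lemma nat_bits_le: "nat_bits k \<le> k + 1"
proof -
  have "floorlog 2 k \<le> k" by (rule floorlog_leI) auto
  then show ?thesis by (simp add: nat_bits_def)
qed

lemma nval_le: "(\<And>a. m a \<le> K) \<Longrightarrow> nval e m \<le> nbound e K"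
  by (induction e) (auto intro: add_mono mult_mono order_trans[OF diff_le_self])

lemma ncost_le: "(\<And>a. m a \<le> K) \<Longrightarrow> ncost e m \<le> ncost_bound e K"
proof (induction e)
  case (NConst k)
  then show ?case using nat_bits_le[of k] by simp
next
  case (NMem a)
  then show ?case
    using nat_bits_le[of "nval (NMem a) m"] nval_le[of m K "NMem a"]
    by (simp only: ncost.simps ncost_bound.simps nbound.simps) (meson add_mono le_trans order_refl)
next
  case (NAdd a b)
  then show ?case
    using nat_bits_le[of "nval (NAdd a b) m"] nval_le[of m K "NAdd a b"]
    by (simp only: ncost.simps ncost_bound.simps) (meson add_mono le_trans order_refl)
next
  case (NSub a b)
  then show ?case
    using nat_bits_le[of "nval (NSub a b) m"] nval_le[of m K "NSub a b"]
    by (simp only: ncost.simps ncost_bound.simps) (meson add_mono le_trans order_refl)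
next
  case (NMul a b)
  then show ?case
    using nat_bits_le[of "nval (NMul a b) m"] nval_le[of m K "NMul a b"]
    by (simp only: ncost.simps ncost_bound.simps) (meson add_mono le_trans order_refl)
qed

text \<open>
  \<open>real_bits\<close> refers to lowest terms, and cancellation makes it awkward to bound along a computation;
  \<open>has_size\<close> is an upper bound on some representation and composes under arithmetic.
\<close>

locale real_measure =
  fixes sz :: "real \<Rightarrow> nat" and has_size :: "nat \<Rightarrow> real \<Rightarrow> bool"
  assumes has_size_mono: "has_size j x \<Longrightarrow> j \<le> k \<Longrightarrow> has_size k x"
    and has_size_nat: "has_size k (real k)"
    and has_size_add: "has_size j x \<Longrightarrow> has_size k y \<Longrightarrow> has_size (j + k + 1) (x + y)"
    and has_size_diff: "has_size j x \<Longrightarrow> has_size k y \<Longrightarrow> has_size (j + k + 1) (x - y)"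
    and has_size_mult: "has_size j x \<Longrightarrow> has_size k y \<Longrightarrow> has_size (j + k + 1) (x * y)"
    and has_size_divide: "has_size j x \<Longrightarrow> has_size k y \<Longrightarrow> has_size (j + k + 1) (x / y)"
    and sz_le: "has_size k x \<Longrightarrow> sz x \<le> 2 * k + 6"
begin

section \<open>A Hoare logic with cost bounds, over an abstract size of real numbers\<close>

lemma has_size_0: "has_size k 0"
  using has_size_nat[of 0] has_size_mono by force

definition bounded :: "nat \<Rightarrow> nmem \<Rightarrow> rmem \<Rightarrow> bool" where
  "bounded K m x \<longleftrightarrow> (\<forall>a. m a \<le> K) \<and> (\<forall>a. has_size K (x a))"

lemma has_size_rval: "bounded K m x \<Longrightarrow> has_size (rbound e K) (rval e m x)"
proof (induction e)
  case (RNat a)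
  then have "nval a m \<le> nbound a K" by (intro nval_le) (simp add: bounded_def)
  with has_size_nat has_size_mono show ?case by force
qed (auto simp: bounded_def has_size_add has_size_diff has_size_mult has_size_divide
    simp flip: One_nat_def add_Suc_right)

lemma sz_rval_le: "bounded K m x \<Longrightarrow> sz (rval e m x) \<le> 2 * rbound e K + 6"
  using has_size_rval sz_le by blast

lemma rcost_le: "bounded K m x \<Longrightarrow> rcost sz e m x \<le> rcost_bound e K"
proof (induction e)
  case (RNat a)
  then have "ncost a m \<le> ncost_bound a K" by (intro ncost_le) (simp add: bounded_def)
  with sz_rval_le[OF RNat, of "RNat a"] show ?case by simp
next
  case (RMem a)
  then have "ncost a m \<le> ncost_bound a K" by (intro ncost_le) (simp add: bounded_def)
  with sz_rval_le[OF RMem, of "RMem a"] show ?case by simp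
next
  case (RAdd a b)
  from sz_rval_le[OF RAdd.prems, of "RAdd a b"] RAdd.IH[OF RAdd.prems] show ?case
    unfolding rcost.simps rcost_bound.simps by linarith
next
  case (RSub a b)
  from sz_rval_le[OF RSub.prems, of "RSub a b"] RSub.IH[OF RSub.prems] show ?case
    unfolding rcost.simps rcost_bound.simps by linarith
next
  case (RMul a b)
  from sz_rval_le[OF RMul.prems, of "RMul a b"] RMul.IH[OF RMul.prems] show ?case
    unfolding rcost.simps rcost_bound.simps by linarith
next
  case (RDiv a b)
  from sz_rval_le[OF RDiv.prems, of "RDiv a b"] RDiv.IH[OF RDiv.prems] show ?case
    unfolding rcost.simps rcost_bound.simps by linarith
qed

lemma bcost_le: "bounded K m x \<Longrightarrow> bcost sz b m x \<le> bcost_bound b K"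
proof (induction b)
  case (NLe a b)
  then have "ncost a m \<le> ncost_bound a K" "ncost b m \<le> ncost_bound b K"
    by (auto intro: ncost_le simp: bounded_def)
  then show ?case by simp
next
  case (RLe a b)
  then have "rcost sz a m x \<le> rcost_bound a K" "rcost sz b m x \<le> rcost_bound b K"
    by (auto intro: rcost_le)
  then show ?case by simp
qed auto

text \<open>Total correctness with running time. Boundedness of all cells is built in, so assertions
  need not mention it and the cost bound depends only on the text of the command and on
  \<open>K\<close>.\<close>

definition triple ::
    "nat \<Rightarrow> (nmem \<Rightarrow> rmem \<Rightarrow> bool) \<Rightarrow> com \<Rightarrow> (nmem \<Rightarrow> rmem \<Rightarrow> bool) \<Rightarrow> bool" where
  "triple K P C Q \<longleftrightarrow>
     (\<forall>m x. bounded K m x \<longrightarrow> P m x \<longrightarrow>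
        (\<exists>k m' x'. exec sz C (m, x) k (m', x') \<and> k \<le> ccost_bound C K \<and> bounded K m' x' \<and> Q m' x'))"

lemma tripleE:
  assumes "triple K P C Q" "bounded K m x" "P m x"
  obtains k m' x' where "exec sz C (m, x) k (m', x')" "k \<le> ccost_bound C K" "bounded K m' x'" "Q m' x'"
  using assms unfolding triple_def by blast

lemma triple_strengthen_pre:
  assumes "triple K P C Q" "\<And>m x. P' m x \<Longrightarrow> P m x"
  shows "triple K P' C Q"
  using assms unfolding triple_def by blast

lemma triple_weaken_post:
  assumes "triple K P C Q" "\<And>m x. Q m x \<Longrightarrow> Q' m x"
  shows "triple K P C Q'"
  using assms unfolding triple_def by metis

lemma triple_Skip: "(\<And>m x. P m x \<Longrightarrow> Q m x) \<Longrightarrow> triple K P Skip Q"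
  unfolding triple_def by (metis ccost_bound.simps(1) exec.Skip order_refl)

lemma triple_NStore:
  assumes "\<And>m x. P m x \<Longrightarrow> nval e m \<le> K \<and> Q (m(nval a m := nval e m)) x"
  shows "triple K P (NStore a e) Q"
  unfolding triple_def
proof (intro allI impI)
  fix m x assume K: "bounded K m x" and P: "P m x"
  have "ncost a m \<le> ncost_bound a K" "ncost e m \<le> ncost_bound e K"
    using K by (auto intro: ncost_le simp: bounded_def)
  moreover have "bounded K (m(nval a m := nval e m)) x"
    using K assms[OF P] by (simp add: bounded_def)
  ultimately show "\<exists>k m' x'. exec sz (NStore a e) (m, x) k (m', x') \<and>
      k \<le> ccost_bound (NStore a e) K \<and> bounded K m' x' \<and> Q m' x'"
    using assms[OF P] exec.NStore[of sz a e m x]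
    by (intro exI[of _ "ncost a m + ncost e m + 1"] exI[of _ "m(nval a m := nval e m)"] exI[of _ x]) simp
qed

lemma triple_RStore:
  assumes "\<And>m x. P m x \<Longrightarrow> has_size K (rval e m x) \<and> Q m (x(nval a m := rval e m x))"
  shows "triple K P (RStore a e) Q"
  unfolding triple_def
proof (intro allI impI)
  fix m x assume K: "bounded K m x" and P: "P m x"
  have "ncost a m \<le> ncost_bound a K"
    using K by (auto intro: ncost_le simp: bounded_def)
  moreover have "rcost sz e m x \<le> rcost_bound e K" using K by (rule rcost_le)
  moreover have "bounded K m (x(nval a m := rval e m x))"
    using K assms[OF P] by (simp add: bounded_def)
  ultimately show "\<exists>k m' x'. exec sz (RStore a e) (m, x) k (m', x') \<and>
      k \<le> ccost_bound (RStore a e) K \<and> bounded K m' x' \<and> Q m' x'"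
    using assms[OF P] exec.RStore[of sz a e m x]
    by (intro exI[of _ "ncost a m + rcost sz e m x + 1"] exI[of _ m]
        exI[of _ "x(nval a m := rval e m x)"]) simp
qed

lemma triple_Seq:
  assumes "triple K P C Q" "triple K Q D R"
  shows "triple K P (Seq C D) R"
  unfolding triple_def
proof (intro allI impI)
  fix m x assume "bounded K m x" "P m x"
  with assms(1) obtain k m1 x1 where 1: "exec sz C (m, x) k (m1, x1)" "k \<le> ccost_bound C K"
    "bounded K m1 x1" "Q m1 x1" by (rule tripleE)
  with assms(2) obtain l m2 x2 where 2: "exec sz D (m1, x1) l (m2, x2)" "l \<le> ccost_bound D K"
    "bounded K m2 x2" "R m2 x2" by (blast elim: tripleE)
  from exec.Seq[OF 1(1) 2(1)] 1 2
  show "\<exists>k m' x'. exec sz (Seq C D) (m, x) k (m', x') \<and>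
      k \<le> ccost_bound (Seq C D) K \<and> bounded K m' x' \<and> R m' x'"
    by (intro exI[of _ "k + l"] exI[of _ m2] exI[of _ x2]) simp
qed

lemma triple_Cond:
  assumes "triple K (\<lambda>m x. P m x \<and> bval b m x) C Q" "triple K (\<lambda>m x. P m x \<and> \<not> bval b m x) D Q"
  shows "triple K P (Cond b C D) Q"
  unfolding triple_def
proof (intro allI impI)
  fix m x assume K: "bounded K m x" and P: "P m x"
  note b = bcost_le[OF K, of b]
  show "\<exists>k m' x'. exec sz (Cond b C D) (m, x) k (m', x') \<and>
      k \<le> ccost_bound (Cond b C D) K \<and> bounded K m' x' \<and> Q m' x'"
  proof (cases "bval b m x")
    case True
    with assms(1) K P obtain k m' x' where 1: "exec sz C (m, x) k (m', x')" "k \<le> ccost_bound C K"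
      "bounded K m' x'" "Q m' x'" by (blast elim: tripleE)
    from exec.CondTrue[OF True 1(1)] 1 b show ?thesis
      by (intro exI[of _ "bcost sz b m x + k"] exI[of _ m'] exI[of _ x']) simp
  next
    case False
    with assms(2) K P obtain k m' x' where 1: "exec sz D (m, x) k (m', x')" "k \<le> ccost_bound D K"
      "bounded K m' x'" "Q m' x'" by (blast elim: tripleE)
    from exec.CondFalse[OF False 1(1)] 1 b show ?thesis
      by (intro exI[of _ "bcost sz b m x + k"] exI[of _ m'] exI[of _ x']) simp
  qed
qed

text \<open>The number \<open>N\<close> of iterations is fixed in advance and indexes the invariant,
  so termination is immediate and \<open>N \<le> K\<close> yields the factor \<open>K\<close> of the
  cost bound.\<close>

lemma triple_Loop:
  assumes body: "\<And>j. j < N \<Longrightarrow> triple K (J j) C (J (Suc j))"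
    and continue: "\<And>j m x. J j m x \<Longrightarrow> j < N \<Longrightarrow> bval b m x"
    and stop: "\<And>m x. J N m x \<Longrightarrow> \<not> bval b m x"
    and "N \<le> K"
  shows "triple K (J 0) (Loop b C) (J N)"
proof -
  let ?step = "bcost_bound b K + ccost_bound C K"
  have "\<exists>k m' x'. exec sz (Loop b C) (m, x) k (m', x') \<and>
      k \<le> (N - j) * ?step + bcost_bound b K \<and> bounded K m' x' \<and> J N m' x'"
    if "j \<le> N" "bounded K m x" "J j m x" for j m x
    using that
  proof (induction j arbitrary: m x rule: inc_induct)
    case base
    from exec.LoopFalse[OF stop[OF base(2)]] base bcost_le[OF base(1), of b] show ?case
      by (intro exI[of _ "bcost sz b m x"] exI[of _ m] exI[of _ x]) simp
  next
    case (step j)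
    from body[OF step.hyps(2)] step.prems obtain k m1 x1 where
      1: "exec sz C (m, x) k (m1, x1)" "k \<le> ccost_bound C K" "bounded K m1 x1" "J (Suc j) m1 x1"
      by (rule tripleE)
    from step.IH[OF 1(3,4)] obtain l m2 x2 where
      2: "exec sz (Loop b C) (m1, x1) l (m2, x2)"
        "l \<le> (N - Suc j) * ?step + bcost_bound b K" "bounded K m2 x2" "J N m2 x2"
      by blast
    have "N - j = Suc (N - Suc j)" using step.hyps by simp
    then have "(N - j) * ?step = ?step + (N - Suc j) * ?step" by simp
    with 1(2) 2(2) bcost_le[OF step.prems(1), of b]
    have "bcost sz b m x + k + l \<le> (N - j) * ?step + bcost_bound b K" by linarith
    with exec.LoopTrue[OF continue[OF step.prems(2) step.hyps(2)] 1(1) 2(1)] 2 show ?case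
      by blast
  qed
  note run = this
  show ?thesis
    unfolding triple_def
  proof (intro allI impI)
    fix m x assume "bounded K m x" "J 0 m x"
    from run[OF _ this] obtain k m' x' where
      1: "exec sz (Loop b C) (m, x) k (m', x')" "k \<le> N * ?step + bcost_bound b K"
        "bounded K m' x'" "J N m' x'" by auto
    have "N * ?step \<le> K * ?step" using \<open>N \<le> K\<close> by (rule mult_le_mono1)
    with 1(2) have "k \<le> ccost_bound (Loop b C) K" unfolding ccost_bound.simps by linarith
    with 1 show "\<exists>k m' x'. exec sz (Loop b C) (m, x) k (m', x') \<and>
        k \<le> ccost_bound (Loop b C) K \<and> bounded K m' x' \<and> J N m' x'" by blast
  qed
qed

text \<open>Besides the usual substitution, each assignment demands that the stored value fits into
  \<open>K\<close>; this maintains the boundedness built into \<open>triple\<close>.\<close>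

primrec wp :: "nat \<Rightarrow> com \<Rightarrow> (nmem \<Rightarrow> rmem \<Rightarrow> bool) \<Rightarrow> nmem \<Rightarrow> rmem \<Rightarrow> bool" where
  "wp K Skip Q = Q"
| "wp K (NStore a e) Q = (\<lambda>m x. nval e m \<le> K \<and> Q (m(nval a m := nval e m)) x)"
| "wp K (RStore a e) Q = (\<lambda>m x. has_size K (rval e m x) \<and> Q m (x(nval a m := rval e m x)))"
| "wp K (Seq C D) Q = wp K C (wp K D Q)"
| "wp K (Cond b C D) Q = (\<lambda>m x. if bval b m x then wp K C Q m x else wp K D Q m x)"
| "wp K (Loop b C) Q = (\<lambda>m x. False)"

lemma triple_wp: "triple K (wp K C Q) C Q"
proof (induction C arbitrary: Q)
  case (Seq C D)
  then show ?case by (auto intro: triple_Seq)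
next
  case (Cond b C D)
  show ?case
    by (rule triple_Cond; rule triple_strengthen_pre, rule Cond.IH) auto
next
  case (Loop b C)
  then show ?case by (simp add: triple_def)
qed (auto intro: triple_Skip triple_NStore triple_RStore)

text \<open>Only useful for loop-free programs, since \<open>wp\<close> of a loop is \<open>False\<close>.\<close>

lemma triple_loop_free:
  "(\<And>m x. P m x \<Longrightarrow> wp K C Q m x) \<Longrightarrow> triple K P C Q"
  using triple_wp triple_strengthen_pre by blast

end


section \<open>The unit-cost and the bit model\<close>

text \<open>With one unit per real no size has to be tracked: the trivial relation discharges every
  size obligation.\<close>

interpretation unit_cost: real_measure "\<lambda>_. 1" "\<lambda>_ _. True"
  by unfold_locales auto

definition frac_size :: "nat \<Rightarrow> real \<Rightarrow> bool" where
  "frac_size k x \<longleftrightarrow>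
     (\<exists>a b :: int. 0 < b \<and> x = of_int a / of_int b \<and> \<bar>a\<bar> \<le> 2 ^ k \<and> b \<le> 2 ^ k)"

lemma frac_sizeI:
  "0 < b \<Longrightarrow> x = of_int a / of_int b \<Longrightarrow> \<bar>a\<bar> \<le> 2 ^ k \<Longrightarrow> b \<le> 2 ^ k \<Longrightarrow> frac_size k x"
  unfolding frac_size_def by blast

lemma frac_size_mono:
  assumes "frac_size j x" "j \<le> k"
  shows "frac_size k x"
proof -
  have "(2::int) ^ j \<le> 2 ^ k" using assms(2) by simp
  moreover from assms(1) obtain a b :: int where
    "0 < b" "x = of_int a / of_int b" "\<bar>a\<bar> \<le> 2 ^ j" "b \<le> 2 ^ j"
    unfolding frac_size_def by blast
  ultimately show ?thesis by (intro frac_sizeI[of b x a]) linarith+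
qed

lemma frac_size_of_nat: "frac_size k (real k)"
proof (rule frac_sizeI[of 1 _ "int k"])
  show "\<bar>int k\<bar> \<le> 2 ^ k" using of_nat_less_two_power[of k, where 'a = int] by simp
qed auto

lemma frac_size_uminus: "frac_size k x \<Longrightarrow> frac_size k (- x)"
  unfolding frac_size_def by (metis abs_minus_cancel minus_divide_left of_int_minus)

text \<open>Over the common denominator \<open>b * d\<close> the numerator is a sum of two products,
  each at most 2 to the power \<open>j + k\<close>; the factor 2 is the additional 1.\<close>

lemma frac_size_add:
  assumes "frac_size j x" "frac_size k y"
  shows "frac_size (j + k + 1) (x + y)"
proof -
  obtain a b c d :: int where ab: "0 < b" "x = of_int a / of_int b" "\<bar>a\<bar> \<le> 2 ^ j" "b \<le> 2 ^ j"
    and cd: "0 < d" "y = of_int c / of_int d" "\<bar>c\<bar> \<le> 2 ^ k" "d \<le> 2 ^ k"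
    using assms unfolding frac_size_def by blast
  show ?thesis
  proof (rule frac_sizeI)
    show "0 < b * d" using ab cd by simp
    show "x + y = of_int (a * d + c * b) / of_int (b * d)"
      using ab cd by (simp add: add_frac_eq)
    have "\<bar>a * d\<bar> \<le> 2 ^ j * 2 ^ k" "\<bar>c * b\<bar> \<le> 2 ^ k * 2 ^ j"
      unfolding abs_mult using ab cd by (auto intro!: mult_mono)
    then show "\<bar>a * d + c * b\<bar> \<le> 2 ^ (j + k + 1)"
      by (simp add: power_add mult.commute)
    have "b * d \<le> 2 ^ j * 2 ^ k" using ab cd by (intro mult_mono) auto
    also have "\<dots> \<le> 2 ^ (j + k + 1)" by (simp add: power_add)
    finally show "b * d \<le> 2 ^ (j + k + 1)" .
  qed
qed

lemma frac_size_mult: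
  assumes "frac_size j x" "frac_size k y"
  shows "frac_size (j + k + 1) (x * y)"
proof -
  obtain a b c d :: int where ab: "0 < b" "x = of_int a / of_int b" "\<bar>a\<bar> \<le> 2 ^ j" "b \<le> 2 ^ j"
    and cd: "0 < d" "y = of_int c / of_int d" "\<bar>c\<bar> \<le> 2 ^ k" "d \<le> 2 ^ k"
    using assms unfolding frac_size_def by blast
  have "frac_size (j + k) (x * y)"
  proof (rule frac_sizeI)
    show "0 < b * d" using ab cd by simp
    show "x * y = of_int (a * c) / of_int (b * d)" using ab cd by simp
    show "\<bar>a * c\<bar> \<le> 2 ^ (j + k)" "b * d \<le> 2 ^ (j + k)"
      unfolding abs_mult power_add using ab cd by (auto intro!: mult_mono)
  qed
  then show ?thesis by (rule frac_size_mono) simp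
qed

lemma frac_size_inverse:
  assumes "frac_size k x"
  shows "frac_size k (inverse x)"
proof -
  obtain a b :: int where ab: "0 < b" "x = of_int a / of_int b" "\<bar>a\<bar> \<le> 2 ^ k" "b \<le> 2 ^ k"
    using assms unfolding frac_size_def by blast
  show ?thesis
  proof (cases "a = 0")
    case True
    \<comment> \<open>By convention \<open>inverse 0 = 0\<close>, which has the representation 0 /
      1.\<close>
    with ab show ?thesis by (intro frac_sizeI[of 1 _ 0]) auto
  next
    case False
    show ?thesis
    proof (rule frac_sizeI)
      show "0 < \<bar>a\<bar>" using False by simp
      show "inverse x = of_int (sgn a * b) / of_int \<bar>a\<bar>"
        using False by (cases "a < 0") (simp_all add: ab(2))
      show "\<bar>sgn a * b\<bar> \<le> 2 ^ k" using ab False by (simp add: abs_mult)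
    qed (use ab in auto)
  qed
qed

lemma real_bits_of_rat:
  "real_bits (of_rat r) = (case quotient_of r of (a, b) \<Rightarrow> nat_bits (nat \<bar>a\<bar>) + nat_bits (nat b))"
proof -
  have "inj (of_rat :: rat \<Rightarrow> real)" by (simp add: inj_on_def)
  then show ?thesis by (simp add: real_bits_def)
qed

text \<open>Cancelling the gcd only shrinks both parts. An integer of absolute value at most 2 to
  the power \<open>k\<close> has at most \<open>k + 1\<close> binary digits, and
  \<open>nat_bits\<close> counts one more.\<close>

lemma real_bits_le:
  assumes "frac_size k x"
  shows "real_bits x \<le> 2 * k + 6"
proof -
  obtain a b :: int where ab: "0 < b" "x = of_int a / of_int b" "\<bar>a\<bar> \<le> 2 ^ k" "b \<le> 2 ^ k"
    using assms unfolding frac_size_def by blast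
  define g where "g = gcd a b"
  have "0 < g" using ab by (simp add: g_def)
  have x: "x = of_rat (Fract a b)" using ab by (simp add: of_rat_rat)
  have q: "quotient_of (Fract a b) = (a div g, b div g)"
    using ab by (simp add: quotient_of_Fract Rat.normalize_def g_def Let_def)
  have bits: "nat_bits (nat \<bar>y div g\<bar>) \<le> k + 2" if "\<bar>y\<bar> \<le> 2 ^ k" "g dvd y" for y
  proof -
    have "\<bar>y div g\<bar> = \<bar>y\<bar> div g" using that(2) \<open>0 < g\<close> by (simp add: abs_div)
    also have "\<dots> \<le> \<bar>y\<bar>" using \<open>0 < g\<close> by (simp add: div_le_dividend int_div_less_self zdiv_mono2[of "\<bar>y\<bar>" 1 g, simplified])
    finally have "\<bar>y div g\<bar> < 2 ^ (k + 1)" using that(1) by (simp add: order_le_less_trans)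
    then have "nat \<bar>y div g\<bar> < 2 ^ (k + 1)"
      by (metis nat_less_iff abs_ge_zero of_nat_numeral of_nat_power)
    then have "floorlog 2 (nat \<bar>y div g\<bar>) \<le> k + 1" by (intro floorlog_leI) auto
    then show ?thesis by (simp add: nat_bits_def)
  qed
  have "\<bar>b div g\<bar> = b div g" using ab \<open>0 < g\<close> by (simp add: pos_imp_zdiv_nonneg_iff)
  with bits[of a] bits[of b] ab show ?thesis
    unfolding x real_bits_of_rat q by (simp add: g_def)
qed

lemma frac_size_real_bits:
  assumes "x \<in> \<rat>"
  shows "frac_size (real_bits x) x"
proof -
  obtain r where r: "x = of_rat r" using assms by (rule Rats_cases)
  obtain a b where q: "quotient_of r = (a, b)" by (cases "quotient_of r") auto
  then have b: "0 < b" and rab: "r = of_int a / of_int b"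
    by (auto simp: quotient_of_denom_pos quotient_of_div)
  have bits: "int y \<le> 2 ^ nat_bits y" for y
  proof -
    have "y < 2 ^ floorlog 2 y"
      using floorlog_bounds[of y 2] by (cases "y = 0") auto
    also have "\<dots> \<le> 2 ^ nat_bits y" by (simp add: nat_bits_def)
    finally have "y \<le> 2 ^ nat_bits y" by simp
    then show ?thesis by (metis of_nat_le_iff of_nat_numeral of_nat_power)
  qed
  have rb: "real_bits x = nat_bits (nat \<bar>a\<bar>) + nat_bits (nat b)"
    by (simp add: r real_bits_of_rat q)
  show ?thesis
  proof (rule frac_sizeI)
    show "0 < b" by fact
    show "x = of_int a / of_int b" unfolding r rab by (simp add: of_rat_divide)
    have "\<bar>a\<bar> \<le> 2 ^ nat_bits (nat \<bar>a\<bar>)" using bits[of "nat \<bar>a\<bar>"] by simp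
    also have "(2::int) ^ nat_bits (nat \<bar>a\<bar>) \<le> 2 ^ real_bits x" by (simp add: rb)
    finally show "\<bar>a\<bar> \<le> 2 ^ real_bits x" .
    have "b \<le> 2 ^ nat_bits (nat b)" using bits[of "nat b"] b by simp
    also have "(2::int) ^ nat_bits (nat b) \<le> 2 ^ real_bits x" by (simp add: rb)
    finally show "b \<le> 2 ^ real_bits x" .
  qed
qed

interpretation bit_cost: real_measure real_bits frac_size
proof
  fix j k x y assume xy: "frac_size j x" "frac_size k y"
  show "frac_size (j + k + 1) (x + y)" "frac_size (j + k + 1) (x * y)"
    using xy by (rule frac_size_add, rule frac_size_mult)
  show "frac_size (j + k + 1) (x - y)"
    using frac_size_add[OF xy(1) frac_size_uminus[OF xy(2)]] by simp
  show "frac_size (j + k + 1) (x / y)"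
    using frac_size_mult[OF xy(1) frac_size_inverse[OF xy(2)]] by (simp add: divide_inverse)
qed (auto intro: frac_size_mono frac_size_of_nat real_bits_le)


section \<open>The program\<close>

text \<open>
  Scratch memory lies behind the input matrices. Natural scratch cells: \<open>0\<close> round counter, \<open>1\<close>
  current vertex, \<open>2\<close> candidate successor, \<open>3\<close> mode (\<open>1\<close> for MinmaxPathApprox), followed by one flag per
  vertex. Real scratch cells: \<open>0\<close> temporary, \<open>1\<close> the largest \<open>\<zeta>\<close> so far, followed by one distance
  per vertex.
\<close>

abbreviation n_exp :: nexp where "n_exp \<equiv> NMem (NConst 0)"

definition scr_exp :: "nat \<Rightarrow> nexp" where
  "scr_exp j = NAdd (NConst (3 + j)) (NMul n_exp n_exp)"

definition flag_exp :: "nexp \<Rightarrow> nexp" where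
  "flag_exp a = NAdd (NAdd (NConst 7) (NMul n_exp n_exp)) a"

definition mat_exp :: "nexp \<Rightarrow> nexp \<Rightarrow> nexp" where
  "mat_exp a b = NAdd (NAdd (NConst 3) (NMul a n_exp)) b"

definition rscr_exp :: "nat \<Rightarrow> nexp" where
  "rscr_exp j = NAdd (NConst (1 + j)) (NMul n_exp n_exp)"

definition dist_exp :: "nexp \<Rightarrow> nexp" where
  "dist_exp a = NAdd (NAdd (NConst 3) (NMul n_exp n_exp)) a"

definition cost_exp :: "nexp \<Rightarrow> nexp \<Rightarrow> nexp" where
  "cost_exp a b = NAdd (NAdd (NConst 1) (NMul a n_exp)) b"

abbreviation v_exp :: nexp where "v_exp \<equiv> NMem (scr_exp 1)"
abbreviation w_exp :: nexp where "w_exp \<equiv> NMem (scr_exp 2)"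
abbreviation arc_cost :: rexp where "arc_cost \<equiv> RMem (cost_exp v_exp w_exp)"

definition For :: "nat \<Rightarrow> com \<Rightarrow> com" where
  "For j C = Seq (NStore (scr_exp j) (NConst 0))
     (Loop (BNot (NLe n_exp (NMem (scr_exp j))))
       (Seq C (NStore (scr_exp j) (NAdd (NMem (scr_exp j)) (NConst 1)))))"

definition combine :: com where
  "combine =
     Cond (NLe (NConst 1) (NMem (scr_exp 3)))
       (Cond (RLe (RMem (dist_exp w_exp)) arc_cost)
         (RStore (rscr_exp 0) arc_cost)
         (RStore (rscr_exp 0) (RMem (dist_exp w_exp))))
       (RStore (rscr_exp 0) (RAdd arc_cost (RMem (dist_exp w_exp))))"

text \<open>At least 1 rather than exactly 1: a marked arc has entry 2 and still counts. The flag
  tells whether the distance cell of \<open>w\<close> holds a valid value.\<close>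

definition arc_test :: bexp where
  "arc_test = BAnd (NLe (NConst 1) (NMem (mat_exp v_exp w_exp))) (NLe (NConst 1) (NMem (flag_exp w_exp)))"

definition relax :: com where
  "relax = Cond arc_test
     (Seq combine
       (Cond (BAnd (NLe (NConst 1) (NMem (flag_exp v_exp))) (RLe (RMem (dist_exp v_exp)) (RMem (rscr_exp 0))))
         Skip
         (Seq (NStore (flag_exp v_exp) (NConst 1)) (RStore (dist_exp v_exp) (RMem (rscr_exp 0))))))
     Skip"

text \<open>A move does not interrupt the scan: it goes on from the new vertex with the remaining
  candidates, so one round may append several edges.\<close>

definition advance :: com where
  "advance = Cond arc_test
     (Seq combine
       (Cond (RLe (RMem (rscr_exp 0)) (RMem (dist_exp v_exp)))
         (Seq (NStore (mat_exp v_exp w_exp) (NConst 2))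
         (Seq (RStore (rscr_exp 1) (RAdd (RMem (rscr_exp 1)) (RMul (RMem (NConst 0)) arc_cost)))
         (Seq (Cond (RLe (RMem (rscr_exp 1)) arc_cost) (RStore (rscr_exp 1) arc_cost) Skip)
              (NStore (scr_exp 1) w_exp))))
         Skip))
     Skip"

definition choose_mode :: com where
  "choose_mode =
     Cond (RLe (RMul (RMul (RMem (NConst 0)) (RMem (NConst 0))) (RNat n_exp)) (RNat (NConst 1)))
       (NStore (scr_exp 3) (NConst 1)) Skip"

text \<open>
  The arcs of the path are marked \<open>2\<close> while the path is traced, so that the other arcs, still \<open>1\<close>,
  remain usable; the final decrement turns the marks into the adjacency matrix of the path.
\<close>

definition combined_prog :: com where
  "combined_prog =
     Seq (Seq choose_mode (NStore (flag_exp (NMem (NConst 2))) (NConst 1)))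
    (Seq (For 0 (For 1 (For 2 relax)))
    (Seq (Seq (NStore (scr_exp 1) (NMem (NConst 1))) (RStore (rscr_exp 1) (RNat (NConst 0))))
    (Seq (For 0 (For 2 advance))
    (Seq (For 1 (For 2 (NStore (mat_exp v_exp w_exp) (NSub (NMem (mat_exp v_exp w_exp)) (NConst 1)))))
         (RStore (NConst 0) (RDiv (RMem (rscr_exp 1)) (RMem (NConst 0))))))))"

text \<open>\<open>S\<close> bounds the size of each input number. In the bound on \<open>K\<close>,
  \<open>n * (2 * S + 2)\<close> accommodates the largest \<zeta> along a walk, \<open>S\<close>
  with one more unit the final division by \<beta>, and \<open>n + 4\<close> the vertices, counters,
  flags and marks.\<close>

locale combined_run = real_measure sz has_size + weighted_dag G c
  for sz has_size and G :: "nat pair_pre_digraph" and c +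
  fixes s t :: nat and \<beta> :: real and n S K :: nat
  assumes verts: "pverts G = {..<n}"
    and s: "s < n" and t: "t < n" and t_reachable: "\<exists>p. awalk s p t"
    and \<beta>: "0 < \<beta>" "\<beta> < 1"
    and size_\<beta>: "has_size S \<beta>"
    and size_cost: "\<And>e. e \<in> parcs G \<Longrightarrow> has_size S (c e)"
    and K: "n * (2 * S + 2) + n + S + 4 \<le> K"
begin

subsection \<open>Memory layout\<close>

definition scr_at :: "nat \<Rightarrow> nat" where "scr_at j = 3 + j + n * n"
definition flag_at :: "nat \<Rightarrow> nat" where "flag_at v = 7 + n * n + v"
definition mat_at :: "nat \<Rightarrow> nat \<Rightarrow> nat" where "mat_at i j = 3 + i * n + j"
definition rscr_at :: "nat \<Rightarrow> nat" where "rscr_at j = 1 + j + n * n"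
definition dist_at :: "nat \<Rightarrow> nat" where "dist_at v = 3 + n * n + v"
definition cost_at :: "nat \<Rightarrow> nat \<Rightarrow> nat" where "cost_at i j = 1 + i * n + j"

lemma index_less: "i < n \<Longrightarrow> j < n \<Longrightarrow> i * n + j < n * n"
proof -
  assume ij: "i < n" "j < n"
  then have "Suc i * n \<le> n * n" by (intro mult_le_mono1) simp
  with ij show ?thesis by simp
qed

lemma index_inject: "j < n \<Longrightarrow> j' < n \<Longrightarrow> i * n + j = i' * n + j' \<longleftrightarrow> i = i' \<and> j = j'"
  by (metis div_mult_self3 div_less mod_less mod_mult_self3 add.right_neutral not_less_zero)

lemma layout_simps [simp]:
  "scr_at i = scr_at j \<longleftrightarrow> i = j" "flag_at v = flag_at w \<longleftrightarrow> v = w" "dist_at v = dist_at w \<longleftrightarrow> v = w"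
  "rscr_at i = rscr_at j \<longleftrightarrow> i = j"
  "scr_at j \<noteq> 0" "scr_at j \<noteq> Suc 0" "scr_at j \<noteq> 2" "0 < scr_at j"
  "flag_at v \<noteq> 0" "flag_at v \<noteq> Suc 0" "flag_at v \<noteq> 2" "0 < flag_at v"
  "mat_at i i' \<noteq> 0" "mat_at i i' \<noteq> Suc 0" "mat_at i i' \<noteq> 2" "0 < mat_at i i'"
  "rscr_at j \<noteq> 0" "0 < rscr_at j" "dist_at v \<noteq> 0" "0 < dist_at v" "cost_at i i' \<noteq> 0" "0 < cost_at i i'"
  "Suc 0 \<noteq> scr_at j" "Suc 0 \<noteq> flag_at v" "Suc 0 \<noteq> mat_at i i'"
  "2 \<noteq> scr_at j" "2 \<noteq> flag_at v" "2 \<noteq> mat_at i i'"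
  by (auto simp: scr_at_def flag_at_def mat_at_def rscr_at_def dist_at_def cost_at_def)

lemma scr_flag_at [simp]: "j < 4 \<Longrightarrow> scr_at j \<noteq> flag_at v" "j < 4 \<Longrightarrow> flag_at v \<noteq> scr_at j"
  by (auto simp: scr_at_def flag_at_def)

lemma rscr_dist_at [simp]: "j < 2 \<Longrightarrow> rscr_at j \<noteq> dist_at v" "j < 2 \<Longrightarrow> dist_at v \<noteq> rscr_at j"
  by (auto simp: rscr_at_def dist_at_def)

lemma mat_at_simps [simp]:
  assumes "i < n" "j < n"
  shows "mat_at i j \<noteq> scr_at k" "scr_at k \<noteq> mat_at i j" "mat_at i j \<noteq> flag_at v" "flag_at v \<noteq> mat_at i j"
    "cost_at i j \<noteq> rscr_at k" "rscr_at k \<noteq> cost_at i j" "cost_at i j \<noteq> dist_at v" "dist_at v \<noteq> cost_at i j"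
  using index_less[OF assms]
  by (auto simp: mat_at_def scr_at_def flag_at_def cost_at_def rscr_at_def dist_at_def)

lemma mat_at_inject [simp]: "j < n \<Longrightarrow> j' < n \<Longrightarrow> mat_at i j = mat_at i' j' \<longleftrightarrow> i = i' \<and> j = j'"
  using index_inject by (simp add: mat_at_def)

text \<open>Address expressions read \<open>n\<close> from cell 0 and denote the intended cells only
  while \<open>m 0 = n\<close>; every loop invariant has to imply this equation.\<close>

lemma nval_layout [simp]:
  assumes "m 0 = n"
  shows "nval (scr_exp j) m = scr_at j" "nval (flag_exp a) m = flag_at (nval a m)"
    "nval (mat_exp a b) m = mat_at (nval a m) (nval b m)" "nval (rscr_exp j) m = rscr_at j"
    "nval (dist_exp a) m = dist_at (nval a m)" "nval (cost_exp a b) m = cost_at (nval a m) (nval b m)"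
  using assms
  by (simp_all add: scr_exp_def flag_exp_def mat_exp_def rscr_exp_def dist_exp_def cost_exp_def
      scr_at_def flag_at_def mat_at_def rscr_at_def dist_at_def cost_at_def)

text \<open>The counter is an ordinary cell: the invariant must survive arbitrary writes to it, and
  the body must hand it back unchanged.\<close>

lemma triple_For:
  assumes init: "\<And>m x. P m x \<Longrightarrow> I 0 m x"
    and n: "\<And>k m x. I k m x \<Longrightarrow> m 0 = n"
    and upd: "\<And>k m x y. I k m x \<Longrightarrow> I k (m(scr_at j := y)) x"
    and body: "\<And>k. k < n \<Longrightarrow>
      triple K (\<lambda>m x. I k m x \<and> m (scr_at j) = k) C (\<lambda>m x. I (Suc k) m x \<and> m (scr_at j) = k)"
  shows "triple K P (For j C) (I n)"
  unfolding For_def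
proof (rule triple_Seq)
  let ?J = "\<lambda>k m x. I k m x \<and> m (scr_at j) = k"
  show "triple K P (NStore (scr_exp j) (NConst 0)) (?J 0)"
  proof (rule triple_NStore)
    fix m x assume "P m x"
    with init have "I 0 m x" by blast
    with n upd show "nval (NConst 0) m \<le> K \<and> ?J 0 (m(nval (scr_exp j) m := nval (NConst 0) m)) x"
      by simp
  qed
  have "triple K (?J 0) (Loop (BNot (NLe n_exp (NMem (scr_exp j))))
      (Seq C (NStore (scr_exp j) (NAdd (NMem (scr_exp j)) (NConst 1))))) (?J n)"
  proof (rule triple_Loop)
    fix k assume "k < n"
    show "triple K (?J k) (Seq C (NStore (scr_exp j) (NAdd (NMem (scr_exp j)) (NConst 1)))) (?J (Suc k))"
    proof (rule triple_Seq[OF body[OF \<open>k < n\<close>]], rule triple_NStore)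
      fix m x assume *: "I (Suc k) m x \<and> m (scr_at j) = k"
      with n have "m 0 = n" by blast
      with * upd \<open>k < n\<close> K
      show "nval (NAdd (NMem (scr_exp j)) (NConst 1)) m \<le> K \<and>
          ?J (Suc k) (m(nval (scr_exp j) m := nval (NAdd (NMem (scr_exp j)) (NConst 1)) m)) x"
        by simp
    qed
  next
    fix k m x assume *: "?J k m x" "k < n"
    then have "m 0 = n" using n by blast
    with * show "bval (BNot (NLe n_exp (NMem (scr_exp j)))) m x" by simp
  next
    fix m x assume *: "?J n m x"
    then have "m 0 = n" using n by blast
    with * show "\<not> bval (BNot (NLe n_exp (NMem (scr_exp j)))) m x" by simp
  next
    show "n \<le> K" using K by simp
  qed
  then show "triple K (?J 0) (Loop (BNot (NLe n_exp (NMem (scr_exp j))))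
      (Seq C (NStore (scr_exp j) (NAdd (NMem (scr_exp j)) (NConst 1))))) (I n)"
    by (rule triple_weaken_post) simp
qed


subsection \<open>Both path problems at once\<close>

definition minmax :: bool where "minmax \<longleftrightarrow> \<beta> * \<beta> * n \<le> 1"

definition comb :: "real \<Rightarrow> real \<Rightarrow> real" where "comb a y = (if minmax then max a y else a + y)"

text \<open>Folding from the target end expresses a walk's value by its first edge and the value of
  its tail, the form that a relaxation needs. The starting value 0 is neutral for \<open>+\<close>,
  and for \<open>max\<close> because costs are non-negative.\<close>

definition path_val :: "(nat \<times> nat) list \<Rightarrow> real" where
  "path_val p = foldr (\<lambda>e. comb (c e)) p 0"

lemma path_val_simps [simp]: "path_val [] = 0" "path_val (e # p) = comb (c e) (path_val p)"
  by (simp_all add: path_val_def)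

text \<open>The exchange arguments below rest on this property. For \<open>max\<close> it is not
  strict, so an optimal walk may have a suboptimal tail.\<close>

lemma comb_mono: "y \<le> y' \<Longrightarrow> comb a y \<le> comb a y'"
  by (auto simp: comb_def)

lemma arcD: "(v, w) \<in> parcs G \<Longrightarrow> v < n \<and> w < n"
  using in_arcsD1 in_arcsD2 verts by blast

lemma awalkD: "awalk v p w \<Longrightarrow> v < n \<and> w < n \<and> length p < n"
  using length_awalk_less[of v p w] awalk_hd_in_verts[of v p w] awalk_last_in_verts[of v p w]
  by (simp add: verts)

lemma path_val_nonneg: "awalk v p w \<Longrightarrow> 0 \<le> path_val p"
proof (induction p arbitrary: v)
  case (Cons e p)
  then have "0 \<le> c e" "0 \<le> path_val p" using cost_nonneg by (auto simp: awalk_Cons_iff)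
  then show ?case by (auto simp: comb_def)
qed simp

lemma has_size_path_val: "awalk v p w \<Longrightarrow> has_size (length p * (S + 1)) (path_val p)"
proof (induction p arbitrary: v)
  case Nil
  then show ?case by (simp add: has_size_0)
next
  case (Cons e p)
  then have e: "has_size S (c e)" and p: "has_size (length p * (S + 1)) (path_val p)"
    using size_cost by (auto simp: awalk_Cons_iff)
  have "has_size (S + length p * (S + 1) + 1) (path_val (e # p))"
    using has_size_add[OF e p] has_size_mono[OF e] has_size_mono[OF p]
    by (simp add: comb_def max_def)
  then show ?case by (rule has_size_mono) simp
qed

lemma has_size_K: "has_size j x \<Longrightarrow> j \<le> n * (2 * S + 2) + n + S + 4 \<Longrightarrow> has_size K x"
  using has_size_mono K order_trans by blast

lemma has_size_K_path_val: "awalk v p w \<Longrightarrow> has_size K (path_val p)"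
proof (rule has_size_K[OF has_size_path_val])
  assume p: "awalk v p w"
  then have "length p \<le> n" using awalkD by force
  then have "length p * (S + 1) \<le> n * (2 * S + 2)" by (intro mult_le_mono) auto
  then show "length p * (S + 1) \<le> n * (2 * S + 2) + n + S + 4" by simp
qed

text \<open>Edges are appended at the end, as in the program: the product with \<beta> takes
  \<open>2 * S + 1\<close> and its addition one more, hence \<open>2 * S + 2\<close> per
  edge.\<close>

lemma has_size_path_zeta: "awalk v p w \<Longrightarrow> has_size (length p * (2 * S + 2)) (path_zeta \<beta> c p)"
proof (induction p arbitrary: w rule: rev_induct)
  case Nil
  then show ?case by (simp add: has_size_0)
next
  case (snoc e p)
  then have e: "e \<in> parcs G" and IH: "has_size (length p * (2 * S + 2)) (path_zeta \<beta> c p)"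
    by (auto simp: awalk_Cons_iff)
  note 1 = size_cost[OF e]
  note 2 = has_size_add[OF IH has_size_mult[OF size_\<beta> 1]]
  show ?case
    using has_size_mono[OF 1] has_size_mono[OF 2] cost_nonneg[OF e] \<beta>
    by (simp add: path_zeta_snoc max_def)
qed

lemma has_size_K_next_zeta:
  assumes "awalk v (p @ [e]) w"
  shows "has_size K (path_zeta \<beta> c p + \<beta> * c e)"
proof -
  have "awalk v p (awlast v p)" and e: "e \<in> parcs G"
    using assms by (auto simp: awalk_Cons_iff)
  note 1 = has_size_add[OF has_size_path_zeta[OF this(1)] has_size_mult[OF size_\<beta> size_cost[OF e]]]
  have "Suc (length p) < n" using awalkD[OF assms] by simp
  then have "Suc (length p) * (2 * S + 2) \<le> n * (2 * S + 2)" by (intro mult_le_mono1) simp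
  then show ?thesis by (intro has_size_K[OF 1]) simp
qed

lemma has_size_K_reward:
  assumes "awalk v p w"
  shows "has_size K (path_zeta \<beta> c p / \<beta>)"
proof -
  note 1 = has_size_divide[OF has_size_path_zeta[OF assms] size_\<beta>]
  have "length p * (2 * S + 2) \<le> n * (2 * S + 2)" using awalkD[OF assms] by (intro mult_le_mono1) simp
  then show ?thesis by (intro has_size_K[OF 1]) simp
qed

lemma has_size_K_cost: "e \<in> parcs G \<Longrightarrow> has_size K (c e)"
  using size_cost by (rule has_size_K) simp_all

definition reach :: "nat \<Rightarrow> bool" where "reach v \<longleftrightarrow> (\<exists>p. awalk v p t)"

definition opt :: "nat \<Rightarrow> real" where "opt v = Min (path_val ` {p. awalk v p t})"

lemma opt_le: "awalk v p t \<Longrightarrow> opt v \<le> path_val p"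
  unfolding opt_def using finite_awalks by (intro Min_le) auto

lemma opt_attained:
  assumes "reach v"
  shows "\<exists>p. awalk v p t \<and> opt v = path_val p"
proof -
  have "path_val ` {p. awalk v p t} \<noteq> {}" using assms by (simp add: reach_def)
  with finite_awalks have "opt v \<in> path_val ` {p. awalk v p t}"
    unfolding opt_def by (intro Min_in finite_imageI)
  then show ?thesis by blast
qed

text \<open>The reverse inequality holds by minimality. Following such edges cannot run in circles
  despite ties, because the graph is acyclic.\<close>

definition tight :: "nat \<Rightarrow> nat \<Rightarrow> bool" where
  "tight u w \<longleftrightarrow> (u, w) \<in> parcs G \<and> reach w \<and> comb (c (u, w)) (opt w) \<le> opt u"

text \<open>The first edge of an optimal walk qualifies even if the tail is suboptimal: an optimal
  tail in its place cannot increase the value.\<close>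

lemma tight_exists:
  assumes "reach u" "u \<noteq> t"
  obtains w where "tight u w" "w < n"
proof -
  obtain p where p: "awalk u p t" "opt u = path_val p" using opt_attained[OF assms(1)] by blast
  with assms(2) obtain e q where q: "p = e # q" by (cases p) (auto simp: awalk_Nil_iff)
  then have e: "e \<in> parcs G" "fst e = u" "awalk (snd e) q t" using p by (auto simp: awalk_Cons_iff)
  then have "comb (c e) (opt (snd e)) \<le> opt u"
    using p q comb_mono[OF opt_le] by simp
  then have "tight u (snd e)" using e by (auto simp: tight_def reach_def)
  moreover have "snd e < n" using e awalkD by blast
  ultimately show thesis by (rule that)
qed


subsection \<open>Verification of the program\<close>

definition base :: "nmem \<Rightarrow> rmem \<Rightarrow> bool" where
  "base m x \<longleftrightarrow> m 0 = n \<and> m 1 = s \<and> m 2 = t \<and> x 0 = \<beta> \<and> (1 \<le> m (scr_at 3) \<longleftrightarrow> minmax) \<and>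
     (\<forall>e\<in>parcs G. x (cost_at (fst e) (snd e)) = c e)"

lemma base_cong:
  assumes "base m x" "m' 0 = m 0" "m' 1 = m 1" "m' 2 = m 2" "x' 0 = x 0"
    "m' (scr_at 3) = m (scr_at 3)" "\<And>i j. i < n \<Longrightarrow> j < n \<Longrightarrow> x' (cost_at i j) = x (cost_at i j)"
  shows "base m' x'"
  using assms arcD unfolding base_def by (metis prod.collapse)

lemma wp_combine:
  assumes "base m x" "m (scr_at 1) = v" "m (scr_at 2) = w" "(v, w) \<in> parcs G"
    and "has_size K (comb (c (v, w)) (x (dist_at w)))"
    and "Q m (x(rscr_at 0 := comb (c (v, w)) (x (dist_at w))))"
  shows "wp K combine Q m x"
proof -
  have "m 0 = n" "1 \<le> m (scr_at 3) \<longleftrightarrow> minmax" "x (cost_at v w) = c (v, w)"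
    using assms(1,4) unfolding base_def by force+
  with assms(2-) show ?thesis by (auto simp: combine_def comb_def max_def split: if_splits)
qed

section \<open>The Bellman-Ford search\<close>

definition marked :: "(nat \<times> nat) set \<Rightarrow> nmem \<Rightarrow> bool" where
  "marked A m \<longleftrightarrow> (\<forall>i<n. \<forall>j<n. m (mat_at i j) =
     (if (i, j) \<in> A then 2 else if (i, j) \<in> parcs G then 1 else 0))"

text \<open>An upper bound and not an equality: updates happen in place, so a round may already use
  values improved in the same round. The matching lower bound comes from
  \<open>sound\<close>.\<close>

definition reached :: "nmem \<Rightarrow> rmem \<Rightarrow> nat \<Rightarrow> real \<Rightarrow> bool" where
  "reached m x v y \<longleftrightarrow> 1 \<le> m (flag_at v) \<and> x (dist_at v) \<le> y"

definition sound :: "nmem \<Rightarrow> rmem \<Rightarrow> bool" where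
  "sound m x \<longleftrightarrow> (\<forall>v<n. 1 \<le> m (flag_at v) \<longrightarrow> (\<exists>p. awalk v p t \<and> x (dist_at v) = path_val p))"

text \<open>After \<open>k\<close> full rounds and the relaxation of the pairs in \<open>D\<close>.\<close>

definition bellman_ford :: "nat \<Rightarrow> (nat \<times> nat) set \<Rightarrow> nmem \<Rightarrow> rmem \<Rightarrow> bool" where
  "bellman_ford k D m x \<longleftrightarrow> base m x \<and> marked {} m \<and> sound m x \<and>
     (\<forall>v p. awalk v p t \<and> length p \<le> k \<longrightarrow> reached m x v (path_val p)) \<and>
     (\<forall>v w q. (v, w) \<in> D \<inter> parcs G \<and> awalk w q t \<and> length q \<le> k \<longrightarrow>
        reached m x v (path_val ((v, w) # q)))"

lemma bellman_ford_cong: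
  assumes "bellman_ford k D m x" "base m' x'"
    "\<And>i j. i < n \<Longrightarrow> j < n \<Longrightarrow> m' (mat_at i j) = m (mat_at i j)"
    "\<And>v. v < n \<Longrightarrow> m' (flag_at v) = m (flag_at v)" "\<And>v. v < n \<Longrightarrow> x' (dist_at v) = x (dist_at v)"
  shows "bellman_ford k D m' x'"
proof -
  have "reached m' x' v y \<longleftrightarrow> reached m x v y" if "v < n" for v y
    using assms(4,5) that by (simp add: reached_def)
  moreover have "sound m' x'" using assms unfolding bellman_ford_def sound_def by metis
  moreover have "marked {} m'" using assms unfolding bellman_ford_def marked_def by metis
  ultimately show ?thesis using assms(1,2) awalkD arcD unfolding bellman_ford_def by (metis IntD2)
qed

lemma bellman_ford_round:
  assumes "bellman_ford k D m x" "{..<n} \<times> {..<n} \<subseteq> D"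
  shows "bellman_ford (Suc k) {} m x"
proof -
  have "reached m x v (path_val p)" if p: "awalk v p t" "length p \<le> Suc k" for v p
  proof (cases p)
    case Nil
    with assms(1) p show ?thesis unfolding bellman_ford_def by (metis le0 list.size(3))
  next
    case (Cons e q)
    with p have e: "e \<in> parcs G" "v = fst e" "awalk (snd e) q t" "length q \<le> k"
      by (auto simp: awalk_Cons_iff)
    have eq: "e = (v, snd e)" using e by simp
    with e have "(v, snd e) \<in> parcs G" by simp
    with assms(2) arcD have "(v, snd e) \<in> D \<inter> parcs G" by blast
    with assms(1) e Cons eq show ?thesis unfolding bellman_ford_def by metis
  qed
  with assms(1) show ?thesis unfolding bellman_ford_def by blast
qed

text \<open>Covers every outcome of a relaxation. Stored values only improve, so bounds already
  achieved survive, and the new pair is settled by monotonicity from the value that \<open>w\<close>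
  had before the step.\<close>

lemma bellman_ford_relax:
  assumes inv: "bellman_ford k D m x" and vw: "v < n" "w < n"
    and keep: "\<And>y. y < n \<Longrightarrow> y \<noteq> v \<Longrightarrow> m' (flag_at y) = m (flag_at y) \<and> x' (dist_at y) = x (dist_at y)"
    and v: "1 \<le> m (flag_at v) \<Longrightarrow> 1 \<le> m' (flag_at v) \<and> x' (dist_at v) \<le> x (dist_at v)"
    and relaxed: "(v, w) \<in> parcs G \<Longrightarrow> 1 \<le> m (flag_at w) \<Longrightarrow>
      1 \<le> m' (flag_at v) \<and> x' (dist_at v) \<le> comb (c (v, w)) (x (dist_at w))"
    and sound: "1 \<le> m' (flag_at v) \<Longrightarrow> \<exists>p. awalk v p t \<and> x' (dist_at v) = path_val p"
    and base: "base m' x'" and mat: "\<And>i j. i < n \<Longrightarrow> j < n \<Longrightarrow> m' (mat_at i j) = m (mat_at i j)"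
  shows "bellman_ford k (insert (v, w) D) m' x'"
proof -
  have mono: "reached m' x' u y" if "reached m x u y" "u < n" for u y
    using that keep[of u] v unfolding reached_def by (cases "u = v") auto
  have "sound m' x'"
    using inv keep sound unfolding bellman_ford_def sound_def by metis
  moreover have "marked {} m'" using inv mat unfolding bellman_ford_def marked_def by metis
  moreover have "reached m' x' u (path_val p)" if "awalk u p t" "length p \<le> k" for u p
    using inv that mono awalkD unfolding bellman_ford_def by blast
  moreover have "reached m' x' u (path_val ((u, u') # q))"
    if "(u, u') \<in> insert (v, w) D \<inter> parcs G" "awalk u' q t" "length q \<le> k" for u u' q
  proof (cases "(u, u') = (v, w)")
    case True
    then have "reached m x w (path_val q)" using inv that unfolding bellman_ford_def by blast
    then have "1 \<le> m (flag_at w)" "x (dist_at w) \<le> path_val q" by (auto simp: reached_def)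
    with relaxed True that show ?thesis
      using comb_mono[of "x (dist_at w)" "path_val q" "c (v, w)"] by (auto simp: reached_def)
  next
    case False
    with that have "(u, u') \<in> D \<inter> parcs G" by auto
    with inv that have "reached m x u (path_val ((u, u') # q))" unfolding bellman_ford_def by blast
    with mono arcD that show ?thesis by blast
  qed
  ultimately show ?thesis using base unfolding bellman_ford_def by blast
qed

lemma relax_correct:
  assumes "v < n" "w < n"
  shows "triple K
    (\<lambda>m x. bellman_ford k D m x \<and> m (scr_at 0) = k \<and> m (scr_at 1) = v \<and> m (scr_at 2) = w) relax
    (\<lambda>m x. bellman_ford k (insert (v, w) D) m x \<and> m (scr_at 0) = k \<and> m (scr_at 1) = v \<and> m (scr_at 2) = w)"
proof (rule triple_loop_free, elim conjE)
  fix m x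
  assume inv: "bellman_ford k D m x" and m: "m (scr_at 0) = k" "m (scr_at 1) = v" "m (scr_at 2) = w"
  let ?Q = "\<lambda>m x. bellman_ford k (insert (v, w) D) m x \<and>
    m (scr_at 0) = k \<and> m (scr_at 1) = v \<and> m (scr_at 2) = w"
  have base: "base m x" and [simp]: "m 0 = n"
    and arc: "1 \<le> m (mat_at v w) \<longleftrightarrow> (v, w) \<in> parcs G" and sound: "sound m x"
    using inv assms by (auto simp: bellman_ford_def base_def marked_def)
  have test: "bval arc_test m x \<longleftrightarrow> (v, w) \<in> parcs G \<and> 1 \<le> m (flag_at w)"
    using m arc by (simp add: arc_test_def)
  show "wp K relax ?Q m x"
  proof (cases "bval arc_test m x")
    case False
    have "bellman_ford k (insert (v, w) D) m x"
      using inv assms False test sound base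
      by (intro bellman_ford_relax[OF inv assms]) (auto simp: sound_def)
    with False m show ?thesis by (simp add: relax_def)
  next
    case True
    with test have vw: "(v, w) \<in> parcs G" "1 \<le> m (flag_at w)" by auto
    with sound assms obtain q where q: "awalk w q t" "x (dist_at w) = path_val q"
      by (auto simp: sound_def)
    let ?y = "comb (c (v, w)) (x (dist_at w))"
    have walk: "awalk v ((v, w) # q) t" "?y = path_val ((v, w) # q)"
      using q vw by (auto simp: awalk_Cons_iff)
    then have size: "has_size K ?y" using has_size_K_path_val by metis
    let ?x = "x(rscr_at 0 := ?y)"
    have base': "base m ?x" using base by (rule base_cong) auto
    have "wp K (Cond (BAnd (NLe (NConst 1) (NMem (flag_exp v_exp))) (RLe (RMem (dist_exp v_exp)) (RMem (rscr_exp 0))))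
         Skip (Seq (NStore (flag_exp v_exp) (NConst 1)) (RStore (dist_exp v_exp) (RMem (rscr_exp 0))))) ?Q m ?x"
    proof (cases "1 \<le> m (flag_at v) \<and> x (dist_at v) \<le> ?y")
      case True
      have "bellman_ford k (insert (v, w) D) m ?x"
        using True sound assms base'
        by (intro bellman_ford_relax[OF inv assms]) (auto simp: sound_def)
      with True m show ?thesis by simp
    next
      case False
      let ?m' = "m(flag_at v := 1)" and ?x' = "?x(dist_at v := ?y)"
      have "base ?m' ?x'" using base' by (rule base_cong) (auto simp: assms)
      then have "bellman_ford k (insert (v, w) D) ?m' ?x'"
        using False walk
        by (intro bellman_ford_relax[OF inv assms]) (auto simp del: path_val_simps)
      with False m size K show ?thesis by auto
    qed
    then have "wp K combine (wp K (Cond (BAnd (NLe (NConst 1) (NMem (flag_exp v_exp)))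
        (RLe (RMem (dist_exp v_exp)) (RMem (rscr_exp 0)))) Skip
        (Seq (NStore (flag_exp v_exp) (NConst 1)) (RStore (dist_exp v_exp) (RMem (rscr_exp 0))))) ?Q) m x"
      by (intro wp_combine[OF base m(2,3) vw(1) size])
    with True show ?thesis by (simp only: relax_def wp.simps if_True)
  qed
qed

text \<open>The premise \<open>(v, w) \<notin> D\<close> of the body records that each pair is
  visited only once, on which the decrement of the matrix entries depends.\<close>

lemma triple_For_pairs:
  assumes n: "\<And>D m x. I D m x \<Longrightarrow> m 0 = n"
    and upd: "\<And>D m x j y. I D m x \<Longrightarrow> j = 1 \<or> j = 2 \<Longrightarrow> I D (m(scr_at j := y)) x"
    and body: "\<And>D v w. v < n \<Longrightarrow> w < n \<Longrightarrow> (v, w) \<notin> D \<Longrightarrow>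
      triple K (\<lambda>m x. I D m x \<and> m (scr_at 1) = v \<and> m (scr_at 2) = w) C
        (\<lambda>m x. I (insert (v, w) D) m x \<and> m (scr_at 1) = v \<and> m (scr_at 2) = w)"
  shows "triple K (I {}) (For 1 (For 2 C)) (I ({..<n} \<times> {..<n}))"
proof (rule triple_For[where I = "\<lambda>v. I ({..<v} \<times> {..<n})"])
  fix v assume "v < n"
  let ?D = "\<lambda>w. {..<v} \<times> {..<n} \<union> {v} \<times> {..<w}"
  let ?I = "\<lambda>w m x. I (?D w) m x \<and> m (scr_at 1) = v"
  have "triple K (\<lambda>m x. I ({..<v} \<times> {..<n}) m x \<and> m (scr_at 1) = v) (For 2 C) (?I n)"
  proof (rule triple_For[where I = ?I])
    fix w assume "w < n"
    have "(v, w) \<notin> ?D w" by simp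
    from body[OF \<open>v < n\<close> \<open>w < n\<close> this]
    have "triple K (\<lambda>m x. I (?D w) m x \<and> m (scr_at 1) = v \<and> m (scr_at 2) = w) C
        (\<lambda>m x. I (insert (v, w) (?D w)) m x \<and> m (scr_at 1) = v \<and> m (scr_at 2) = w)" .
    moreover have "insert (v, w) (?D w) = ?D (Suc w)" by auto
    ultimately show "triple K (\<lambda>m x. ?I w m x \<and> m (scr_at 2) = w) C
        (\<lambda>m x. ?I (Suc w) m x \<and> m (scr_at 2) = w)"
      by (simp only: conj_assoc)
  next
    fix w m x y assume "?I w m x"
    then show "?I w (m(scr_at 2 := y)) x" using upd[of "?D w" m x 2 y] by simp
  qed (simp, use n in blast)
  moreover have "?D n = {..<Suc v} \<times> {..<n}" by auto
  ultimately show "triple K (\<lambda>m x. I ({..<v} \<times> {..<n}) m x \<and> m (scr_at 1) = v) (For 2 C)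
      (\<lambda>m x. I ({..<Suc v} \<times> {..<n}) m x \<and> m (scr_at 1) = v)"
    by simp
next
  fix v m x y assume "I ({..<v} \<times> {..<n}) m x"
  then show "I ({..<v} \<times> {..<n}) (m(scr_at 1 := y)) x" using upd by blast
qed (simp, use n in blast)

lemma bellman_ford_scr:
  assumes "bellman_ford k D m x" "j < 3"
  shows "bellman_ford k D (m(scr_at j := y)) x"
proof -
  have "base (m(scr_at j := y)) x"
    using assms unfolding bellman_ford_def by (auto elim: base_cong)
  with assms show ?thesis by (elim bellman_ford_cong) auto
qed

lemma bellman_ford_correct:
  "triple K (bellman_ford 0 {}) (For 0 (For 1 (For 2 relax))) (bellman_ford n {})"
proof (rule triple_For[where I = "\<lambda>k. bellman_ford k {}"])
  fix k
  let ?I = "\<lambda>D m x. bellman_ford k D m x \<and> m (scr_at 0) = k"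
  have "triple K (?I {}) (For 1 (For 2 relax)) (?I ({..<n} \<times> {..<n}))"
  proof (rule triple_For_pairs[where I = ?I])
    fix D v w assume "v < n" "w < n"
    from relax_correct[OF this, of k D]
    show "triple K (\<lambda>m x. ?I D m x \<and> m (scr_at 1) = v \<and> m (scr_at 2) = w) relax
        (\<lambda>m x. ?I (insert (v, w) D) m x \<and> m (scr_at 1) = v \<and> m (scr_at 2) = w)"
      by (simp only: conj_assoc)
  qed (auto simp: bellman_ford_scr, simp add: bellman_ford_def base_def)
  then show "triple K (\<lambda>m x. bellman_ford k {} m x \<and> m (scr_at 0) = k) (For 1 (For 2 relax))
      (\<lambda>m x. bellman_ford (Suc k) {} m x \<and> m (scr_at 0) = k)"
    by (rule triple_weaken_post) (auto intro: bellman_ford_round)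
qed (auto simp: bellman_ford_scr, simp add: bellman_ford_def base_def)

section \<open>Tracing an optimal walk forwards\<close>

definition final :: "nmem \<Rightarrow> rmem \<Rightarrow> bool" where
  "final m x \<longleftrightarrow> (\<forall>v<n. (1 \<le> m (flag_at v) \<longleftrightarrow> reach v) \<and> (reach v \<longrightarrow> x (dist_at v) = opt v))"

lemma final_cong:
  assumes "final m x" "\<And>v. v < n \<Longrightarrow> m' (flag_at v) = m (flag_at v)"
    "\<And>v. v < n \<Longrightarrow> x' (dist_at v) = x (dist_at v)"
  shows "final m' x'"
  using assms unfolding final_def by simp

text \<open>Acyclicity limits walks to fewer than \<open>n\<close> arcs, so \<open>n\<close> rounds
  cover them all; soundness excludes values below the optimum.\<close>

lemma bellman_ford_final:
  assumes "bellman_ford n {} m x"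
  shows "final m x"
  unfolding final_def
proof (intro allI impI)
  fix v assume "v < n"
  have reached: "reached m x v (path_val p)" if "awalk v p t" for p
    using assms that awalkD[OF that] unfolding bellman_ford_def by (simp add: less_imp_le)
  have sound: "\<exists>p. awalk v p t \<and> x (dist_at v) = path_val p" if "1 \<le> m (flag_at v)"
    using assms that \<open>v < n\<close> unfolding bellman_ford_def sound_def by simp
  have flag: "1 \<le> m (flag_at v) \<longleftrightarrow> reach v"
    using reached sound unfolding reach_def reached_def by blast
  moreover have "x (dist_at v) = opt v" if "reach v"
  proof (rule antisym)
    show "x (dist_at v) \<le> opt v"
      using opt_attained[OF that] reached unfolding reached_def by metis
    show "opt v \<le> x (dist_at v)"
      using sound flag that opt_le by metis
  qed
  ultimately show "(1 \<le> m (flag_at v) \<longleftrightarrow> reach v) \<and> (reach v \<longrightarrow> x (dist_at v) = opt v)"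
    by blast
qed

text \<open>Optimality of the unfinished walk \<open>p\<close> is expressed through its completions:
  any optimal tail from the current vertex makes it optimal from \<open>s\<close>.\<close>

definition tracing :: "(nat \<times> nat) list \<Rightarrow> nat \<Rightarrow> nmem \<Rightarrow> rmem \<Rightarrow> bool" where
  "tracing p u m x \<longleftrightarrow> base m x \<and> final m x \<and> marked (set p) m \<and> m (scr_at 1) = u \<and>
     awalk s p u \<and> reach u \<and> x (rscr_at 1) = path_zeta \<beta> c p \<and>
     (\<forall>q. awalk u q t \<and> path_val q \<le> opt u \<longrightarrow> path_val (p @ q) \<le> opt s)"

lemma tracing_scr:
  assumes "tracing p u m x" "j = 0 \<or> j = 2"
  shows "tracing p u (m(scr_at j := y)) x"
proof -
  have "base (m(scr_at j := y)) x"
    using assms unfolding tracing_def by (auto elim: base_cong)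
  moreover have "final (m(scr_at j := y)) x"
    using assms unfolding tracing_def by (auto elim: final_cong)
  ultimately show ?thesis using assms unfolding tracing_def by (auto simp: marked_def)
qed

text \<open>The state within round \<open>k\<close> after the candidates below \<open>w\<close>. A
  move leaves the scan of the new vertex incomplete, but by then the length exceeds \<open>k\<close>
  and the round has done its duty.\<close>

definition progress :: "nat \<Rightarrow> nat \<Rightarrow> (nat \<times> nat) list \<Rightarrow> nat \<Rightarrow> bool" where
  "progress k w p u \<longleftrightarrow> u = t \<or> k < length p \<or> k \<le> length p \<and> (\<forall>w'<w. \<not> tight u w')"

text \<open>Such an edge would close a cycle; hence a trace that has arrived stays at
  \<open>t\<close>.\<close>

lemma not_tight_target: "\<not> tight t w"
proof
  assume "tight t w"
  then obtain q where "(t, w) \<in> parcs G" "awalk w q t" by (auto simp: tight_def reach_def)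
  then have "awalk t ((t, w) # q) t" by (simp add: awalk_Cons_iff)
  then show False using closed_awalk_Nil by blast
qed

lemma advance_correct:
  assumes "w < n"
  shows "triple K
    (\<lambda>m x. (\<exists>p u. tracing p u m x \<and> progress k w p u) \<and> m (scr_at 0) = k \<and> m (scr_at 2) = w)
    advance
    (\<lambda>m x. (\<exists>p u. tracing p u m x \<and> progress k (Suc w) p u) \<and> m (scr_at 0) = k \<and> m (scr_at 2) = w)"
proof (rule triple_loop_free, elim conjE exE)
  fix m x p u
  assume trace: "tracing p u m x" and progress: "progress k w p u"
    and m: "m (scr_at 0) = k" "m (scr_at 2) = w"
  let ?Q = "\<lambda>m x. (\<exists>p u. tracing p u m x \<and> progress k (Suc w) p u) \<and> m (scr_at 0) = k \<and> m (scr_at 2) = w"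
  have base: "base m x" and final: "final m x" and marked: "marked (set p) m"
    and u: "m (scr_at 1) = u" and walk: "awalk s p u" and "reach u"
    and zeta: "x (rscr_at 1) = path_zeta \<beta> c p"
    and opt: "\<And>q. awalk u q t \<Longrightarrow> path_val q \<le> opt u \<Longrightarrow> path_val (p @ q) \<le> opt s"
    using trace by (auto simp: tracing_def)
  have [simp]: "m 0 = n" "x 0 = \<beta>" using base by (auto simp: base_def)
  have "u < n" using awalkD[OF walk] by simp
  have p: "set p \<subseteq> parcs G" using walk by blast
  have "1 \<le> m (mat_at u w) \<longleftrightarrow> (u, w) \<in> parcs G"
    using marked p \<open>u < n\<close> assms unfolding marked_def by auto
  then have test: "bval arc_test m x \<longleftrightarrow> (u, w) \<in> parcs G \<and> reach w"
    using m u final assms by (simp add: arc_test_def final_def)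
  have stay: "progress k (Suc w) p u" if "\<not> tight u w"
    using progress that by (auto simp: progress_def less_Suc_eq)
  show "wp K advance ?Q m x"
  proof (cases "bval arc_test m x")
    case False
    with test stay have "progress k (Suc w) p u" by (auto simp: tight_def)
    with trace m False show ?thesis by (auto simp: advance_def)
  next
    case True
    with test have arc: "(u, w) \<in> parcs G" and "reach w" by auto
    have dist: "x (dist_at w) = opt w" "x (dist_at u) = opt u"
      using final \<open>reach w\<close> \<open>reach u\<close> assms \<open>u < n\<close> by (auto simp: final_def)
    let ?y = "comb (c (u, w)) (x (dist_at w))"
    obtain q where q: "awalk w q t" "opt w = path_val q"
      using opt_attained[OF \<open>reach w\<close>] by blast
    then have "awalk u ((u, w) # q) t" "?y = path_val ((u, w) # q)"
      using arc dist by (auto simp: awalk_Cons_iff)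
    then have size: "has_size K ?y" using has_size_K_path_val by metis
    let ?x = "x(rscr_at 0 := ?y)"
    let ?move = "Seq (NStore (mat_exp v_exp w_exp) (NConst 2))
         (Seq (RStore (rscr_exp 1) (RAdd (RMem (rscr_exp 1)) (RMul (RMem (NConst 0)) arc_cost)))
         (Seq (Cond (RLe (RMem (rscr_exp 1)) arc_cost) (RStore (rscr_exp 1) arc_cost) Skip)
              (NStore (scr_exp 1) w_exp)))"
    have cost: "x (cost_at u w) = c (u, w)" using base arc by (force simp: base_def)
    have "wp K (Cond (RLe (RMem (rscr_exp 0)) (RMem (dist_exp v_exp))) ?move Skip) ?Q m ?x"
    proof (cases "?y \<le> opt u")
      case False
      then have "progress k (Suc w) p u" using stay dist by (auto simp: tight_def)
      moreover have "base m ?x" using base by (rule base_cong) auto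
      moreover have "final m ?x" using final by (rule final_cong) auto
      ultimately have "tracing p u m ?x \<and> progress k (Suc w) p u"
        using trace by (auto simp: tracing_def)
      with False m u dist show ?thesis by auto
    next
      case True
      let ?p = "p @ [(u, w)]"
      let ?m' = "m(mat_at u w := 2, scr_at 1 := w)"
      let ?x' = "?x(rscr_at 1 := path_zeta \<beta> c ?p)"
      have walk': "awalk s ?p w"
        using walk arc awalk_last_in_verts[OF q(1)] assms verts by (auto simp: awalk_simps)
      have tight: "tight u w" using True arc \<open>reach w\<close> dist by (simp add: tight_def)
      have "base ?m' ?x'" using base by (rule base_cong) (auto simp: assms \<open>u < n\<close>)
      moreover have "final ?m' ?x'" using final by (rule final_cong) (auto simp: assms \<open>u < n\<close>)
      moreover have "marked (set ?p) ?m'"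
        using marked assms \<open>u < n\<close> by (auto simp: marked_def)
      \<comment> \<open>A tail from \<open>w\<close>, with the new edge put in front, is an
        admissible completion of \<open>p\<close>.\<close>
      moreover have "path_val (?p @ q) \<le> opt s" if "awalk w q t" "path_val q \<le> opt w" for q
      proof -
        have "path_val ((u, w) # q) \<le> opt u"
          using comb_mono[OF that(2), of "c (u, w)"] True dist by simp
        moreover have "awalk u ((u, w) # q) t" using that arc by (simp add: awalk_Cons_iff)
        ultimately show ?thesis using opt by fastforce
      qed
      ultimately have "tracing ?p w ?m' ?x'"
        using walk' \<open>reach w\<close> by (simp add: tracing_def)
      moreover have "progress k (Suc w) ?p w"
        using progress tight not_tight_target by (auto simp: progress_def)
      ultimately have post: "?Q ?m' ?x'" using m assms \<open>u < n\<close> by auto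
      have zeta': "path_zeta \<beta> c ?p = max (path_zeta \<beta> c p + \<beta> * c (u, w)) (c (u, w))"
        using path_zeta_snoc[of \<beta> c "(u, w)" p] \<beta> cost_nonneg[OF arc] by simp
      note sizes = has_size_K_next_zeta[OF walk'] has_size_K_cost[OF arc]
      \<comment> \<open>The program stores the sum and overwrites it if the edge cost is at least as
        large; the two cases are the two arguments of the maximum.\<close>
      have move: "wp K ?move Q m ?x" if "Q ?m' ?x'" for Q
        using that sizes K assms \<open>u < n\<close>
        by (cases "path_zeta \<beta> c p + \<beta> * c (u, w) \<le> c (u, w)")
          (simp_all add: zeta' m cost u[unfolded One_nat_def] zeta[unfolded One_nat_def])
      from True m u dist have "bval (RLe (RMem (rscr_exp 0)) (RMem (dist_exp v_exp))) m ?x" by simp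
      with move[of ?Q, OF post] show ?thesis by (simp only: wp.simps(5) if_True)
    qed
    then have "wp K combine (wp K (Cond (RLe (RMem (rscr_exp 0)) (RMem (dist_exp v_exp))) ?move Skip) ?Q) m x"
      by (intro wp_combine[OF base u m(2) arc size])
    with True show ?thesis by (simp only: advance_def wp.simps(4,5) if_True)
  qed
qed

text \<open>Away from \<open>t\<close> a tight edge exists, so a full round gains an edge; as walks
  have fewer than \<open>n\<close> arcs, \<open>n\<close> rounds end at \<open>t\<close>.\<close>

lemma trace_correct:
  "triple K (tracing [] s) (For 0 (For 2 advance)) (\<lambda>m x. \<exists>p. tracing p t m x)"
proof -
  let ?I = "\<lambda>k m x. \<exists>p u. tracing p u m x \<and> (u = t \<or> k \<le> length p)"
  have n: "m 0 = n" if "tracing p u m x" for p u m x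
    using that by (simp add: tracing_def base_def)
  have "triple K (tracing [] s) (For 0 (For 2 advance)) (?I n)"
  proof (rule triple_For[where I = ?I])
    fix k
    let ?J = "\<lambda>w m x. (\<exists>p u. tracing p u m x \<and> progress k w p u) \<and> m (scr_at 0) = k"
    have "triple K (\<lambda>m x. ?I k m x \<and> m (scr_at 0) = k) (For 2 advance) (?J n)"
    proof (rule triple_For[where I = ?J])
      fix w assume "w < n"
      from advance_correct[OF this, of k]
      show "triple K (\<lambda>m x. ?J w m x \<and> m (scr_at 2) = w) advance
          (\<lambda>m x. ?J (Suc w) m x \<and> m (scr_at 2) = w)"
        by (simp only: conj_assoc)
    next
      fix m x assume "?I k m x \<and> m (scr_at 0) = k"
      then show "?J 0 m x" by (auto simp: progress_def)
    next
      fix w m x y assume "?J w m x"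
      moreover have "(m(scr_at 2 := y)) (scr_at 0) = m (scr_at 0)" by simp
      ultimately show "?J w (m(scr_at 2 := y)) x" using tracing_scr by metis
    qed (use n in blast)
    then show "triple K (\<lambda>m x. ?I k m x \<and> m (scr_at 0) = k) (For 2 advance)
        (\<lambda>m x. ?I (Suc k) m x \<and> m (scr_at 0) = k)"
    proof (rule triple_weaken_post)
      fix m x assume "?J n m x"
      then obtain p u where *: "tracing p u m x" "progress k n p u" "m (scr_at 0) = k" by blast
      then have "reach u" by (simp add: tracing_def)
      then have "u = t \<or> Suc k \<le> length p"
        using *(2) tight_exists[of u] unfolding progress_def by (metis Suc_le_eq)
      with * show "?I (Suc k) m x \<and> m (scr_at 0) = k" by blast
    qed
  next
    fix k m x y assume "?I k m x"
    then show "?I k (m(scr_at 0 := y)) x" using tracing_scr by blast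
  qed (use n in blast)+
  then show ?thesis
  proof (rule triple_weaken_post)
    fix m x assume "?I n m x"
    then obtain p u where *: "tracing p u m x" "u = t \<or> n \<le> length p" by blast
    then have "length p < n" using awalkD[of s p u] by (simp add: tracing_def)
    with * show "\<exists>p. tracing p t m x" by auto
  qed
qed

section \<open>Turning the marks into the output graph\<close>

definition optimal :: "(nat \<times> nat) list \<Rightarrow> bool" where
  "optimal p \<longleftrightarrow> awalk s p t \<and> path_val p \<le> opt s"

text \<open>Truncated subtraction of 1 does the whole conversion: path arcs go from 2 to 1, other
  arcs from 1 to 0, and absent arcs remain 0.\<close>

definition unmarking :: "(nat \<times> nat) set \<Rightarrow> nmem \<Rightarrow> rmem \<Rightarrow> bool" where
  "unmarking D m x \<longleftrightarrow> m 0 = n \<and> x 0 = \<beta> \<and> (\<exists>p. optimal p \<and> x (rscr_at 1) = path_zeta \<beta> c p \<and>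
     (\<forall>i<n. \<forall>j<n. m (mat_at i j) =
        (if (i, j) \<in> set p then 2 else if (i, j) \<in> parcs G then 1 else 0) -
        (if (i, j) \<in> D then 1 else 0)))"

lemma tracing_imp_unmarking:
  assumes "tracing p t m x"
  shows "unmarking {} m x"
proof -
  \<comment> \<open>The empty walk is an admissible completion at \<open>t\<close>, since its value
    0 does not exceed the non-negative \<open>opt t\<close>; so \<open>p\<close> itself is
    optimal.\<close>
  have "awalk t [] t" using t verts by (simp add: awalk_Nil_iff)
  moreover have "0 \<le> opt t"
    using assms opt_attained[of t] path_val_nonneg unfolding tracing_def by metis
  moreover have "awalk s p t"
    and "\<And>q. awalk t q t \<Longrightarrow> path_val q \<le> opt t \<Longrightarrow> path_val (p @ q) \<le> opt s"
    using assms by (auto simp: tracing_def)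
  ultimately have "optimal p" by (metis append_Nil2 optimal_def path_val_simps(1))
  with assms show ?thesis
    by (auto simp: unmarking_def tracing_def base_def marked_def intro!: exI[of _ p])
qed

lemma unmark_correct:
  "triple K (unmarking {}) (For 1 (For 2 (NStore (mat_exp v_exp w_exp) (NSub (NMem (mat_exp v_exp w_exp)) (NConst 1)))))
    (unmarking ({..<n} \<times> {..<n}))"
proof (rule triple_For_pairs[where I = unmarking])
  fix D v w assume vw: "v < n" "w < n" "(v, w) \<notin> D"
  let ?dec = "NStore (mat_exp v_exp w_exp) (NSub (NMem (mat_exp v_exp w_exp)) (NConst 1))"
  show "triple K (\<lambda>m x. unmarking D m x \<and> m (scr_at 1) = v \<and> m (scr_at 2) = w) ?dec
      (\<lambda>m x. unmarking (insert (v, w) D) m x \<and> m (scr_at 1) = v \<and> m (scr_at 2) = w)"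
  proof (rule triple_loop_free, elim conjE)
    fix m x assume un: "unmarking D m x" and m: "m (scr_at 1) = v" "m (scr_at 2) = w"
    have [simp]: "m 0 = n" using un by (simp add: unmarking_def)
    have "m (mat_at v w) \<le> 2" using un vw by (auto simp: unmarking_def)
    moreover have "unmarking (insert (v, w) D) (m(mat_at v w := m (mat_at v w) - 1)) x"
      using un vw unfolding unmarking_def by (elim conjE exE) (intro conjI exI, auto)
    ultimately show "wp K ?dec (\<lambda>m x. unmarking (insert (v, w) D) m x \<and> m (scr_at 1) = v \<and> m (scr_at 2) = w) m x"
      using m vw K by simp
  qed
qed (auto simp: unmarking_def)

definition result :: "nmem \<Rightarrow> rmem \<Rightarrow> bool" where
  "result m x \<longleftrightarrow> (\<exists>p. optimal p \<and> x 0 = path_zeta \<beta> c p / \<beta> \<and>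
     (\<forall>i<n. \<forall>j<n. m (mat_at i j) = (if (i, j) \<in> set p then 1 else 0)))"

text \<open>All cells behind the input are 0, so the distance of \<open>t\<close> is already correct
  and only its flag has to be set.\<close>

lemma initial_correct:
  "triple K (\<lambda>m x. m = input_nmem G s t \<and> x = input_rmem \<beta> G c)
    (Seq choose_mode (NStore (flag_exp (NMem (NConst 2))) (NConst 1))) (bellman_ford 0 {})"
proof (rule triple_loop_free, elim conjE)
  fix m x assume mx: "m = input_nmem G s t" "x = input_rmem \<beta> G c"
  have card: "card (pverts G) = n" by (simp add: verts)
  have m [simp]: "m 0 = n" "m (Suc 0) = s" "m 2 = t" "\<And>j. m (scr_at j) = 0" "\<And>v. m (flag_at v) = 0"
    by (auto simp: mx input_nmem_def card Let_def scr_at_def flag_at_def)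
  have mat: "m (mat_at i j) = (if (i, j) \<in> parcs G then 1 else 0)" if "i < n" "j < n" for i j
    using that index_less[OF that] by (simp add: mx input_nmem_def card Let_def mat_at_def)
  have x [simp]: "x 0 = \<beta>" "\<And>v. x (dist_at v) = 0"
    by (auto simp: mx input_rmem_def card Let_def dist_at_def)
  have cost: "x (cost_at i j) = c (i, j)" if "(i, j) \<in> parcs G" for i j
  proof -
    have "i < n" "j < n" using arcD that by auto
    with that index_less[OF this] show ?thesis
      by (simp add: mx input_rmem_def card Let_def cost_at_def)
  qed
  let ?mode = "if minmax then m(scr_at 3 := 1) else m"
  let ?m = "?mode(flag_at t := 1)"
  have "base ?m x" using cost by (auto simp: base_def)
  moreover have "marked {} ?m" using mat t by (auto simp: marked_def)
  moreover have "awalk t [] t" using t verts by (simp add: awalk_Nil_iff)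
  then have "sound ?m x" by (auto simp: sound_def intro!: exI[of _ "[]"])
  moreover have "reached ?m x v (path_val p)" if "awalk v p t" "length p \<le> 0" for v p
    using that by (auto simp: reached_def awalk_Nil_iff)
  ultimately have "bellman_ford 0 {} ?m x" by (simp add: bellman_ford_def)
  then show "wp K (Seq choose_mode (NStore (flag_exp (NMem (NConst 2))) (NConst 1))) (bellman_ford 0 {}) m x"
    using K by (auto simp: choose_mode_def minmax_def split: if_splits)
qed

lemma combined_prog_correct:
  "triple K (\<lambda>m x. m = input_nmem G s t \<and> x = input_rmem \<beta> G c) combined_prog result"
  unfolding combined_prog_def
proof (rule triple_Seq[OF initial_correct], rule triple_Seq[OF bellman_ford_correct], rule triple_Seq)
  let ?start = "Seq (NStore (scr_exp 1) (NMem (NConst 1))) (RStore (rscr_exp 1) (RNat (NConst 0)))"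
  show "triple K (bellman_ford n {}) ?start (tracing [] s)"
  proof (rule triple_loop_free)
    fix m x assume inv: "bellman_ford n {} m x"
    then have base: "base m x" and "marked {} m" by (auto simp: bellman_ford_def)
    then have [simp]: "m 0 = n" "m (Suc 0) = s" by (auto simp: base_def)
    let ?m = "m(scr_at 1 := s)" and ?x = "x(rscr_at 1 := 0)"
    have "base ?m ?x" using base by (rule base_cong) auto
    moreover have "final ?m ?x" using bellman_ford_final[OF inv] by (rule final_cong) auto
    moreover have "marked {} ?m" using \<open>marked {} m\<close> by (auto simp: marked_def)
    moreover have "reach s" using t_reachable by (simp add: reach_def)
    ultimately have "tracing [] s ?m ?x"
      using s verts by (simp add: tracing_def awalk_Nil_iff)
    then show "wp K ?start (tracing [] s) m x" using s K has_size_0 by simp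
  qed
  show "triple K (tracing [] s) (Seq (For 0 (For 2 advance))
      (Seq (For 1 (For 2 (NStore (mat_exp v_exp w_exp) (NSub (NMem (mat_exp v_exp w_exp)) (NConst 1)))))
        (RStore (NConst 0) (RDiv (RMem (rscr_exp 1)) (RMem (NConst 0)))))) result"
  proof (rule triple_Seq[OF trace_correct], rule triple_Seq)
    show "triple K (\<lambda>m x. \<exists>p. tracing p t m x)
        (For 1 (For 2 (NStore (mat_exp v_exp w_exp) (NSub (NMem (mat_exp v_exp w_exp)) (NConst 1)))))
        (unmarking ({..<n} \<times> {..<n}))"
      by (rule triple_strengthen_pre[OF unmark_correct]) (use tracing_imp_unmarking in blast)
    show "triple K (unmarking ({..<n} \<times> {..<n}))
        (RStore (NConst 0) (RDiv (RMem (rscr_exp 1)) (RMem (NConst 0)))) result"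
    proof (rule triple_loop_free)
      fix m x assume "unmarking ({..<n} \<times> {..<n}) m x"
      then obtain p where [simp]: "m 0 = n" "x 0 = \<beta>" and p: "optimal p"
        "x (rscr_at 1) = path_zeta \<beta> c p"
        "\<And>i j. i < n \<Longrightarrow> j < n \<Longrightarrow> m (mat_at i j) =
          (if (i, j) \<in> set p then 2 else if (i, j) \<in> parcs G then 1 else 0) - 1"
        unfolding unmarking_def by auto
      have "result m (x(0 := path_zeta \<beta> c p / \<beta>))"
        using p by (auto simp: result_def intro!: exI[of _ p])
      moreover have "has_size K (path_zeta \<beta> c p / \<beta>)"
        using p(1) has_size_K_reward unfolding optimal_def by blast
      ultimately show "wp K (RStore (NConst 0) (RDiv (RMem (rscr_exp 1)) (RMem (NConst 0)))) result m x"
        using p(2) by simp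
    qed
  qed
qed


subsection \<open>The output\<close>

lemma minmax_iff: "minmax \<longleftrightarrow> \<beta> \<le> 1 / sqrt (real (card (pverts G)))"
proof -
  have n: "0 < real n" "card (pverts G) = n" using s by (auto simp: verts)
  have "\<beta> \<le> 1 / sqrt n \<longleftrightarrow> \<beta> * sqrt n \<le> 1" using n by (simp add: field_simps)
  also have "\<dots> \<longleftrightarrow> (\<beta> * sqrt n)\<^sup>2 \<le> 1\<^sup>2"
    using \<beta> by (intro power_mono_iff[symmetric]) auto
  also have "\<dots> \<longleftrightarrow> \<beta> * \<beta> * n \<le> 1"
    by (simp add: power_mult_distrib power2_eq_square[of \<beta>])
  finally show ?thesis by (simp add: minmax_def n)
qed

lemma path_val_minmax:
  assumes minmax "p \<noteq> []" "set p \<subseteq> parcs G"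
  shows "path_val p = Max (c ` set p)"
  using assms(2,3)
proof (induction p rule: list_nonempty_induct)
  case (single e)
  then have "0 \<le> c e" using cost_nonneg by simp
  with assms(1) show ?case by (simp add: comb_def)
next
  case (cons e p)
  with assms(1) show ?case by (simp add: comb_def)
qed

lemma path_val_cheapest: "\<not> minmax \<Longrightarrow> path_val p = awalk_cost c p"
  by (induction p) (simp_all add: comb_def)

lemma optimal_le: "optimal p \<Longrightarrow> awalk s q t \<Longrightarrow> path_val p \<le> path_val q"
  unfolding optimal_def by (meson opt_le order_trans)

lemma optimal_minmax_path:
  assumes minmax "optimal p"
  shows "minmax_path G c s t p"
  unfolding minmax_path_def apath_iff_awalk
proof (intro conjI allI impI)
  show walk: "awalk s p t" using assms(2) by (simp add: optimal_def)
  fix q assume q: "awalk s q t"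
  show "Max (c ` set p) \<le> Max (c ` set q)"
  \<comment> \<open>For \<open>s = t\<close> both walks are empty and the unspecified
    \<open>Max\<close> of the empty set stands on both sides.\<close>
  proof (cases "s = t")
    case True
    with walk q closed_awalk_Nil have "p = []" "q = []" by blast+
    then show ?thesis by simp
  next
    case False
    with walk q awalk_empty_ends have "p \<noteq> []" "q \<noteq> []" by blast+
    moreover have "set p \<subseteq> parcs G" "set q \<subseteq> parcs G" using walk q by blast+
    ultimately show ?thesis using optimal_le[OF assms(2) q] assms(1) by (simp add: path_val_minmax)
  qed
qed

lemma optimal_cheapest_path:
  assumes "\<not> minmax" "optimal p"
  shows "cheapest_path G c s t p"
  using assms optimal_le[OF assms(2)]
  unfolding cheapest_path_def apath_iff_awalk optimal_def
  by (simp add: path_val_cheapest)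

lemma result_combined_approx:
  assumes "result m x"
  shows "combined_approx \<beta> G c s t (output_graph n (m, x)) (output_reward (m, x))"
proof -
  obtain p where p: "optimal p" "x 0 = path_zeta \<beta> c p / \<beta>"
    and m: "\<And>i j. i < n \<Longrightarrow> j < n \<Longrightarrow> m (mat_at i j) = (if (i, j) \<in> set p then 1 else 0)"
    using assms unfolding result_def by blast
  have walk: "awalk s p t" using p(1) by (simp add: optimal_def)
  then have "set p \<subseteq> parcs G" by blast
  then have less: "i < n \<and> j < n" if "(i, j) \<in> set p" for i j using arcD that by blast
  have "(i, j) \<in> set p \<longleftrightarrow> i < n \<and> j < n \<and> m (mat_at i j) = 1" for i j
  proof (cases "i < n \<and> j < n")
    case True
    with m[of i j] show ?thesis by simp
  next
    case False
    with less[of i j] show ?thesis by blast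
  qed
  then have "output_graph n (m, x) = \<lparr>pverts = pverts G, parcs = set p\<rparr>"
    by (auto simp: output_graph_def verts mat_at_def)
  then have "path_output \<beta> G c s t p (output_graph n (m, x)) (output_reward (m, x))"
    using path_output_iff[OF weighted_dag_axioms awalk_imp_apath[OF walk] \<beta>(1)] p(2)
    by (simp add: output_reward_def)
  then show ?thesis
    using optimal_minmax_path[OF _ p(1)] optimal_cheapest_path[OF _ p(1)] minmax_iff
    unfolding combined_approx_def minmax_path_approx_def cheapest_path_approx_def by auto
qed

lemma bounded_input: "bounded K (input_nmem G s t) (input_rmem \<beta> G c)"
proof -
  have "has_size K (c e)" if "e \<in> parcs G" for e using has_size_K_cost that .
  moreover have "has_size K \<beta>" using size_\<beta> by (rule has_size_K) simp
  ultimately show ?thesis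
    using K s t has_size_0 by (simp add: bounded_def input_nmem_def input_rmem_def verts Let_def)
qed

lemma run:
  obtains k \<sigma> where "exec sz combined_prog (input_nmem G s t, input_rmem \<beta> G c) k \<sigma>"
    "k \<le> ccost_bound combined_prog K"
    "combined_approx \<beta> G c s t (output_graph n \<sigma>) (output_reward \<sigma>)"
proof -
  from combined_prog_correct[unfolded triple_def, THEN spec, THEN spec, THEN mp, OF bounded_input]
  obtain k m x where
    "exec sz combined_prog (input_nmem G s t, input_rmem \<beta> G c) k (m, x)"
    "k \<le> ccost_bound combined_prog K" "result m x"
    by (elim impE exE conjE) simp_all
  with result_combined_approx that show thesis by blast
qed

end

text \<open>The lower bound on \<open>K\<close> in \<open>combined_run\<close> with \<open>n\<close>
  replaced by \<open>S\<close>; the input size contains the square of \<open>n\<close> and so is at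
  least \<open>n\<close>.\<close>

definition cell_bound :: "nat \<Rightarrow> nat" where
  "cell_bound S = S * (2 * S + 2) + S + S + 4"

lemma (in real_measure) runs_combined_approx:
  assumes p: "\<And>S. ccost_bound combined_prog (cell_bound S) = poly p S"
    and task: "task_graph G c s t" and verts: "pverts G = {..<card (pverts G)}"
    and \<beta>: "0 < \<beta>" "\<beta> < 1"
    and size: "has_size (sz \<beta>) \<beta>" "\<And>e. e \<in> parcs G \<Longrightarrow> has_size (sz (c e)) (c e)"
  shows "runs_combined_approx_within p sz combined_prog \<beta> G c s t"
proof -
  interpret dag: weighted_dag G c using task by (rule weighted_dag_of_task_graph)
  let ?n = "card (pverts G)" and ?S = "input_size sz \<beta> G c"
  have st: "s \<in> pverts G" "t \<in> pverts G"
    using task by (auto simp: task_graph_def task_graph_axioms_def)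
  interpret combined_run sz has_size G c s t \<beta> ?n ?S "cell_bound ?S"
  proof
    show "pverts G = {..<?n}" by fact
    show "s < ?n" "t < ?n" using st verts by auto
    show "\<exists>p. dag.awalk s p t"
      using task_graph.target_reachable[OF task] by (simp add: dag.reachable_awalk)
    show "has_size ?S \<beta>" using size(1) by (rule has_size_mono) (simp add: input_size_def)
    show "has_size ?S (c e)" if "e \<in> parcs G" for e
    proof (rule has_size_mono[OF size(2)[OF that]])
      have "sz (c e) \<le> (\<Sum>e\<in>parcs G. sz (c e))"
        using that dag.pair_finite_arcs by (intro member_le_sum) auto
      then show "sz (c e) \<le> ?S" by (simp add: input_size_def)
    qed
    have "?n \<le> ?n\<^sup>2" by (simp add: power2_eq_square)
    then have n: "?n \<le> ?S" by (simp add: input_size_def)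
    then have "?n * (2 * ?S + 2) \<le> ?S * (2 * ?S + 2)" by (rule mult_le_mono1)
    with n show "?n * (2 * ?S + 2) + ?n + ?S + 4 \<le> cell_bound ?S" by (simp add: cell_bound_def)
  qed (use \<beta> in auto)
  show ?thesis unfolding runs_combined_approx_within_def using run p by metis
qed

lemma is_poly_cell_bound: "is_poly cell_bound"
  unfolding cell_bound_def by (intro is_poly_intros)

theorem theorem2:
  shows "(\<forall>(G :: 'a pair_pre_digraph) (c :: 'a \<times> 'a \<Rightarrow> real) (s :: 'a) (t :: 'a) (\<beta> :: real).
      task_graph G c s t \<and> 0 < \<beta> \<and> \<beta> < 1 \<longrightarrow>
        (\<exists>H r. combined_approx \<beta> G c s t H r) \<and>
        (\<forall>H r. combined_approx \<beta> G c s t H r \<longrightarrow>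
           spanning (with_proj H) (with_proj G) \<and> 0 \<le> r \<and> motivating \<beta> H c s t r \<and>
           (\<exists>ropt. ms_opt \<beta> G c s t ropt \<and> r \<le> (1 + sqrt (real (card (pverts G)))) * ropt)))
    \<and> (\<exists>(prog :: com) (p :: nat poly).
      \<forall>(G :: nat pair_pre_digraph) (c :: nat \<times> nat \<Rightarrow> real) (s :: nat) (t :: nat) (\<beta> :: real).
        task_graph G c s t \<and> pverts G = {..<card (pverts G)} \<and> 0 < \<beta> \<and> \<beta> < 1 \<longrightarrow>
          runs_combined_approx_within p (\<lambda>_. 1) prog \<beta> G c s t \<and>
          (\<beta> \<in> \<rat> \<and> (\<forall>e\<in>parcs G. c e \<in> \<rat>) \<longrightarrow>
             runs_combined_approx_within p real_bits prog \<beta> G c s t))"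
proof (rule conjI, goal_cases)
  case 1
  show ?case
  proof (intro allI impI, elim conjE)
    fix G :: "'a pair_pre_digraph" and c :: "'a \<times> 'a \<Rightarrow> real" and s t :: 'a and \<beta> :: real
    assume *: "task_graph G c s t" "0 < \<beta>" "\<beta> < 1"
    show "(\<exists>H r. combined_approx \<beta> G c s t H r) \<and>
        (\<forall>H r. combined_approx \<beta> G c s t H r \<longrightarrow>
           spanning (with_proj H) (with_proj G) \<and> 0 \<le> r \<and> motivating \<beta> H c s t r \<and>
           (\<exists>ropt. ms_opt \<beta> G c s t ropt \<and> r \<le> (1 + sqrt (real (card (pverts G)))) * ropt))"
      using combined_approx_exists[OF *(1)] combined_approx_correct[OF *] by simp
  qed
next
  case 2
  \<comment> \<open>\<open>ccost_bound\<close> does not mention the charge for reals, so the same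
    polynomial bounds the run in both models.\<close>
  obtain p where p: "\<And>S. ccost_bound combined_prog (cell_bound S) = poly p S"
    using is_poly_ccost_bound[OF is_poly_cell_bound] unfolding is_poly_def by blast
  show ?case
  proof (intro exI[of _ combined_prog] exI[of _ p] allI impI, elim conjE, intro conjI impI)
    fix G :: "nat pair_pre_digraph" and c s t and \<beta> :: real
    assume *: "task_graph G c s t" "pverts G = {..<card (pverts G)}" "0 < \<beta>" "\<beta> < 1"
    show "runs_combined_approx_within p (\<lambda>_. 1) combined_prog \<beta> G c s t"
      by (rule unit_cost.runs_combined_approx[OF p *]) simp_all
    assume "\<beta> \<in> \<rat> \<and> (\<forall>e\<in>parcs G. c e \<in> \<rat>)"
    then show "runs_combined_approx_within p real_bits combined_prog \<beta> G c s t"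
      by (intro bit_cost.runs_combined_approx[OF p *] frac_size_real_bits) simp_all
  qed
qed

end
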